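(* Let $a_0,a_1,b_1\in\mathbb{R}$ and $p(t)=a_0+a_1\cos t+b_1\sin t$. If $$a_1^2+b_1^2>9a_0^2,$$ then the equation $$\ddot x+\frac14\left(x+1-\frac1{(x+1)^3}\right)=\epsilon p(t),\qquad x\in(-1,+\infty),$$ is resonant for small $\epsilon\ne0$; that is, there exists $\epsilon_0>0$ such that for every $\epsilon$ with $0<|\epsilon|<\epsilon_0$ all its solutions are unbounded.
   Context: A solution $x(t)$ is called unbounded if there is a sequence $(t_n)$ such that $|x(t_n)|+|\dot x(t_n)|\to+\infty$. An equation is called resonant if all of its solutions are unbounded; here $\epsilon\neq0$ is a small parameter. *)

theory Defs
  imports "HOL-Analysis.Analysis"
begin

text \<open>
  Solutions of \<open>x'' + g(x) = q(t)\<close>, with \<open>x\<close> taking values in \<open>D\<close>, on an open interval \<open>I\<close>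
  (bounded or not). Since \<open>I\<close> is open, the values of \<open>x\<close> outside \<open>I\<close> are irrelevant to the
  derivatives below.
\<close>

definition solution_on ::
    "(real \<Rightarrow> real) \<Rightarrow> (real \<Rightarrow> real) \<Rightarrow> real set \<Rightarrow> real set \<Rightarrow> (real \<Rightarrow> real) \<Rightarrow> bool" where
  "solution_on g q D I x \<longleftrightarrow>
     open I \<and> is_interval I \<and> I \<noteq> {} \<and>
     (\<forall>t\<in>I. x t \<in> D
        \<and> x differentiable (at t)
        \<and> deriv x differentiable (at t)
        \<and> deriv (deriv x) t + g (x t) = q t)"

text \<open>
  A solution is understood to be non-continuable; the restriction of a solution to a shorter
  interval would be bounded for trivial reasons. Global existence on the whole real line is not
  built in.
\<close>

definition maximal_solution ::
    "(real \<Rightarrow> real) \<Rightarrow> (real \<Rightarrow> real) \<Rightarrow> real set \<Rightarrow> real set \<Rightarrow> (real \<Rightarrow> real) \<Rightarrow> bool" where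
  "maximal_solution g q D I x \<longleftrightarrow>
     solution_on g q D I x \<and>
     (\<forall>J y. solution_on g q D J y \<and> I \<subseteq> J \<and> (\<forall>t\<in>I. y t = x t) \<longrightarrow> J = I)"

definition unbounded_solution :: "real set \<Rightarrow> (real \<Rightarrow> real) \<Rightarrow> bool" where
  "unbounded_solution I x \<longleftrightarrow>
     (\<exists>s :: nat \<Rightarrow> real. (\<forall>n. s n \<in> I) \<and>
        filterlim (\<lambda>n. \<bar>x (s n)\<bar> + \<bar>deriv x (s n)\<bar>) at_top sequentially)"

definition resonant :: "(real \<Rightarrow> real) \<Rightarrow> (real \<Rightarrow> real) \<Rightarrow> real set \<Rightarrow> bool" where
  "resonant g q D \<longleftrightarrow> (\<forall>I x. maximal_solution g q D I x \<longrightarrow> unbounded_solution I x)"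

end

theory Submission
  imports Defs
begin

text \<open>
  For \<open>u = x + 1\<close> the unforced equation is Pinney's equation, whose solutions satisfy
  \<open>u\<^sup>2 = A + X cos t + Y sin t\<close> with constants \<open>A\<^sup>2 = 1 + X\<^sup>2 + Y\<^sup>2\<close>. Under the forcing \<open>q\<close> the
  quantities \<open>A\<close>, \<open>X\<close>, \<open>Y\<close> vary slowly. After a shift of time \<open>p t = a + \<rho> cos t\<close> with
  \<open>\<rho> > 3 \<bar>a\<bar>\<close>, and \<open>Y + 4 \<epsilon> p u sin t\<close> has the derivative
  \<open>\<epsilon> u (\<rho> + 5 \<rho> cos 2t + 6 a cos t)\<close>. Along an unforced orbit the integral of
  \<open>u (\<rho> + 5 \<rho> cos 2t + 6 a cos t)\<close> over a period is at least \<open>2 (\<rho> - 3 \<bar>a\<bar>) sqrt A\<close>, and over one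
  period the forced solution stays within \<open>o(1) sqrt A\<close> of such an orbit as \<open>\<epsilon> \<rightarrow> 0\<close>, uniformly in
  the orbit. Since \<open>Y = 2 u u'\<close> and \<open>sin t = 0\<close> at multiples of \<open>2\<pi>\<close>, the sequence
  \<open>\<epsilon> u(2\<pi>n) u'(2\<pi>n)\<close> grows at least linearly, so no solution on the whole line is bounded. A bounded
  solution that is not global has bounded energy near an endpoint of its interval, which keeps \<open>u\<close>
  away from \<open>0\<close> and makes the solution continuable.
\<close>

section \<open>The averaged drift along an unforced orbit\<close>

lemma periodic_derivative_has_integral_0:
  fixes F g :: "real \<Rightarrow> real"
  assumes "\<And>t. (F has_real_derivative g t) (at t)" and "F (2 * pi) = F 0"
  shows "(g has_integral 0) {0..2 * pi}"
  using fundamental_theorem_of_calculus[of 0 "2 * pi" F g] assms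
  by (auto simp: has_real_derivative_iff_has_vector_derivative has_vector_derivative_at_within)

lemma has_integral_const_2pi: "((\<lambda>_. c) has_integral 2 * pi * c) {0..2 * pi}" for c :: real
  using has_integral_const_real[of c 0 "2 * pi"] by simp

lemma has_integral_eq_cong:
  fixes g h :: "real \<Rightarrow> real"
  assumes "(g has_integral a) S" "(h has_integral b) S" "\<And>t. g t = h t"
  shows "a = b"
proof -
  have "g = h" using assms(3) by blast
  then show ?thesis using assms(1,2) has_integral_unique by blast
qed

text \<open>The constraint places (A, X, Y) on a sheet of a hyperboloid on which A exceeds the
  amplitude \<open>B\<close> of X cos t + Y sin t. This keeps the radicand in \<open>U\<close>
  positive and treats all unforced orbits, small or large, at once.\<close>

locale unperturbed_orbit =
  fixes A X Y :: real
  assumes A_pos: "A > 0" and A_sq: "A\<^sup>2 = 1 + X\<^sup>2 + Y\<^sup>2"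
begin

definition B :: real where "B = sqrt (X\<^sup>2 + Y\<^sup>2)"
definition f :: "real \<Rightarrow> real" where "f t = X * cos t + Y * sin t"
definition f' :: "real \<Rightarrow> real" where "f' t = Y * cos t - X * sin t"
definition U :: "real \<Rightarrow> real" where "U t = sqrt (A + f t)"

lemma B_nonneg: "B \<ge> 0" and B_sq: "B\<^sup>2 = X\<^sup>2 + Y\<^sup>2" and A_sq_B: "A\<^sup>2 = 1 + B\<^sup>2"
  using A_sq by (auto simp: B_def)

lemma B_less_A: "B < A"
proof (rule power2_less_imp_less)
  show "B\<^sup>2 < A\<^sup>2" by (simp add: A_sq_B)
qed (use A_pos in simp)

lemma f_f'_sq: "(f t)\<^sup>2 + (f' t)\<^sup>2 = B\<^sup>2"
proof -
  have "(f t)\<^sup>2 + (f' t)\<^sup>2 = (X\<^sup>2 + Y\<^sup>2) * ((cos t)\<^sup>2 + (sin t)\<^sup>2)"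
    unfolding f_def f'_def by algebra
  then show ?thesis by (simp add: B_sq)
qed

lemma abs_f_le: "\<bar>f t\<bar> \<le> B"
proof (rule power2_le_imp_le)
  show "\<bar>f t\<bar>\<^sup>2 \<le> B\<^sup>2" unfolding f_f'_sq[of t, symmetric] by simp
qed (rule B_nonneg)

lemma U_pos: "U t > 0"
  using abs_f_le[of t] B_less_A by (simp add: U_def)

lemma U_sq: "(U t)\<^sup>2 = A + f t"
  using abs_f_le[of t] B_less_A by (simp add: U_def)

lemma DERIV_f [derivative_intros]: "(f has_real_derivative f' t) (at t)"
  unfolding f_def f'_def by (auto intro!: derivative_eq_intros)

lemma DERIV_f' [derivative_intros]: "(f' has_real_derivative - f t) (at t)"
  unfolding f_def f'_def by (auto intro!: derivative_eq_intros)

lemma DERIV_U [derivative_intros]: "(U has_real_derivative f' t / (2 * U t)) (at t)"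
proof -
  have "A + f t > 0" using abs_f_le[of t] B_less_A by auto
  moreover have "((\<lambda>t. A + f t) has_real_derivative f' t) (at t)"
    by (auto intro!: derivative_eq_intros)
  ultimately have "((\<lambda>t. sqrt (A + f t)) has_real_derivative inverse (sqrt (A + f t)) / 2 * f' t) (at t)"
    by (intro DERIV_chain2[where f = sqrt and g = "\<lambda>t. A + f t"] DERIV_real_sqrt)
  moreover have "inverse (sqrt (A + f t)) / 2 * f' t = f' t / (2 * U t)"
    unfolding U_def by (simp only: divide_inverse inverse_mult_distrib mult_ac)
  moreover have "U = (\<lambda>t. sqrt (A + f t))"
    by (rule ext) (rule U_def)
  ultimately show ?thesis by (simp only:)
qed

lemma continuous_on_f: "continuous_on S f" and continuous_on_U: "continuous_on S U"
  by (rule DERIV_continuous_on, rule has_field_derivative_at_within,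
      rule DERIV_f DERIV_U)+

lemma periodic: "f (2 * pi) = f 0" "f' (2 * pi) = f' 0" "U (2 * pi) = U 0"
  by (simp_all add: f_def f'_def U_def)

text \<open>Integration by parts reduces the drift to \<open>P0\<close> and \<open>P1\<close>. The signs of \<open>P1\<close> and of
  \<open>2 * J2 - B\<^sup>2 * J0\<close> follow from \<open>f t / U t \<le> f t / sqrt A\<close>, whose right side has mean zero.\<close>

definition J0 :: real where "J0 = integral {0..2*pi} U"
definition J1 :: real where "J1 = integral {0..2*pi} (\<lambda>t. U t * f t)"
definition J2 :: real where "J2 = integral {0..2*pi} (\<lambda>t. U t * (f t)\<^sup>2)"
definition P0 :: real where "P0 = integral {0..2*pi} (\<lambda>t. 1 / U t)"
definition P1 :: real where "P1 = integral {0..2*pi} (\<lambda>t. f t / U t)"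
definition P2 :: real where "P2 = integral {0..2*pi} (\<lambda>t. (f t)\<^sup>2 / U t)"

lemma has_integral_basis:
  "(U has_integral J0) {0..2*pi}"
  "((\<lambda>t. U t * f t) has_integral J1) {0..2*pi}"
  "((\<lambda>t. U t * (f t)\<^sup>2) has_integral J2) {0..2*pi}"
  "((\<lambda>t. 1 / U t) has_integral P0) {0..2*pi}"
  "((\<lambda>t. f t / U t) has_integral P1) {0..2*pi}"
  "((\<lambda>t. (f t)\<^sup>2 / U t) has_integral P2) {0..2*pi}"
proof -
  have "U t \<noteq> 0" for t using U_pos[of t] by simp
  then show
    "(U has_integral J0) {0..2*pi}"
    "((\<lambda>t. U t * f t) has_integral J1) {0..2*pi}"
    "((\<lambda>t. U t * (f t)\<^sup>2) has_integral J2) {0..2*pi}"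
    "((\<lambda>t. 1 / U t) has_integral P0) {0..2*pi}"
    "((\<lambda>t. f t / U t) has_integral P1) {0..2*pi}"
    "((\<lambda>t. (f t)\<^sup>2 / U t) has_integral P2) {0..2*pi}"
    unfolding J0_def J1_def J2_def P0_def P1_def P2_def
    by (intro integrable_integral integrable_continuous_interval continuous_on_mult
      continuous_on_divide continuous_on_power continuous_on_const
      continuous_on_f continuous_on_U ballI; assumption)+
qed

text \<open>Everything comes from U^2 = A + f and f^2 + f'^2 = B^2. These identities rewrite the
  integrands that arise by parts as combinations of the six basic ones.\<close>

lemma U_expand: "U t = A * (1 / U t) + f t / U t"
  and U_f_expand: "U t * f t = A * (f t / U t) + (f t)\<^sup>2 / U t"
  and U_cube: "(U t) ^ 3 = A * U t + U t * f t"
  and f'_sq_div: "f' t * (f' t / (2 * U t)) = B\<^sup>2 / 2 * (1 / U t) - 1 / 2 * ((f t)\<^sup>2 / U t)"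
  and f'_sq: "f' t * f' t = B\<^sup>2 - (f t)\<^sup>2"
proof -
  show 1: "f' t * f' t = B\<^sup>2 - (f t)\<^sup>2"
    using f_f'_sq[of t] by (simp add: power2_eq_square)
  have "f' t * (f' t / (2 * U t)) = (f' t * f' t) / (2 * U t)" by simp
  then show "f' t * (f' t / (2 * U t)) = B\<^sup>2 / 2 * (1 / U t) - 1 / 2 * ((f t)\<^sup>2 / U t)"
    unfolding 1 by (simp add: diff_divide_distrib)
  have U: "U t = (A + f t) / U t"
    using U_pos[of t] by (simp add: U_sq[symmetric] power2_eq_square)
  also have "\<dots> = A * (1 / U t) + f t / U t"
    by (simp only: add_divide_distrib) simp
  finally show "U t = A * (1 / U t) + f t / U t" .
  show "U t * f t = A * (f t / U t) + (f t)\<^sup>2 / U t"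
  proof -
    have "U t * f t = (A + f t) / U t * f t" using U by simp
    also have "\<dots> = A * (f t / U t) + (f t)\<^sup>2 / U t"
      by (simp add: power2_eq_square distrib_right add_divide_distrib)
    finally show ?thesis .
  qed
  have "(U t) ^ 3 = (U t)\<^sup>2 * U t" by (simp add: power2_eq_square power3_eq_cube)
  then show "(U t) ^ 3 = A * U t + U t * f t" unfolding U_sq by (simp add: algebra_simps)
qed

section \<open>Linear relations between the orbit integrals\<close>

lemma J0_eq: "J0 = A * P0 + P1"
  by (rule has_integral_eq_cong[OF has_integral_basis(1) _ U_expand])
    (intro has_integral_add has_integral_mult_right has_integral_basis)

lemma J1_eq: "J1 = A * P1 + P2"
  by (rule has_integral_eq_cong[OF has_integral_basis(2) _ U_f_expand])
    (intro has_integral_add has_integral_mult_right has_integral_basis)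

text \<open>Integration by parts: the derivative of f' U has mean zero over a period.\<close>

lemma P2_eq: "3 * P2 = B\<^sup>2 * P0 - 2 * A * P1"
proof -
  have "((\<lambda>t. - f t * U t + f' t * (f' t / (2 * U t))) has_integral 0) {0..2*pi}"
    by (rule periodic_derivative_has_integral_0[where F = "\<lambda>t. f' t * U t"])
      (auto intro!: derivative_eq_intros simp: periodic)
  moreover have "((\<lambda>t. B\<^sup>2 / 2 * (1 / U t) - A * (f t / U t) - 3 / 2 * ((f t)\<^sup>2 / U t))
      has_integral B\<^sup>2 / 2 * P0 - A * P1 - 3 / 2 * P2) {0..2*pi}"
    by (intro has_integral_diff has_integral_mult_right has_integral_basis)
  moreover have "- f t * U t + f' t * (f' t / (2 * U t)) =
      B\<^sup>2 / 2 * (1 / U t) - A * (f t / U t) - 3 / 2 * ((f t)\<^sup>2 / U t)" for t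
    unfolding f'_sq_div using U_f_expand[of t] by (simp add: mult.commute)
  ultimately have "0 = B\<^sup>2 / 2 * P0 - A * P1 - 3 / 2 * P2"
    by (rule has_integral_eq_cong)
  then show ?thesis by simp
qed

text \<open>The same argument with f' U^3, whose derivative involves only the integrands of
  \<open>J0\<close>, \<open>J1\<close> and \<open>J2\<close>.\<close>

lemma J2_eq: "5 * J2 = 3 * B\<^sup>2 * J0 - 2 * A * J1"
proof -
  have "((\<lambda>t. - f t * (U t)^3 + f' t * (3 * (U t)\<^sup>2 * (f' t / (2 * U t)))) has_integral 0) {0..2*pi}"
    by (rule periodic_derivative_has_integral_0[where F = "\<lambda>t. f' t * (U t)^3"])
      (auto intro!: derivative_eq_intros simp: periodic)
  moreover have "((\<lambda>t. 3 / 2 * B\<^sup>2 * U t - A * (U t * f t) - 5 / 2 * (U t * (f t)\<^sup>2))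
      has_integral 3 / 2 * B\<^sup>2 * J0 - A * J1 - 5 / 2 * J2) {0..2*pi}"
    by (intro has_integral_diff has_integral_mult_right has_integral_basis)
  moreover have "- f t * (U t)^3 + f' t * (3 * (U t)\<^sup>2 * (f' t / (2 * U t))) =
      3 / 2 * B\<^sup>2 * U t - A * (U t * f t) - 5 / 2 * (U t * (f t)\<^sup>2)" for t
  proof -
    have "f' t * (3 * (U t)\<^sup>2 * (f' t / (2 * U t))) = 3 / 2 * U t * (f' t * f' t)"
      using U_pos[of t] by (simp add: power2_eq_square)
    then show ?thesis
      unfolding U_cube f'_sq by (simp add: algebra_simps power2_eq_square)
  qed
  ultimately have "0 = 3 / 2 * B\<^sup>2 * J0 - A * J1 - 5 / 2 * J2"
    by (rule has_integral_eq_cong)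
  then show ?thesis by linarith
qed

section \<open>Signs and sizes of the orbit integrals\<close>

lemma f_div_U_le: "f t / U t \<le> f t / sqrt A"
proof (cases "f t \<ge> 0")
  case True
  then have "sqrt A \<le> U t" by (simp add: U_def)
  then show ?thesis using True A_pos U_pos by (simp add: divide_left_mono)
next
  case False
  then have "U t \<le> sqrt A" by (simp add: U_def)
  then show ?thesis using False A_pos U_pos[of t] by (simp add: divide_left_mono_neg)
qed

lemma has_integral_f: "(f has_integral 0) {0..2*pi}"
  by (rule periodic_derivative_has_integral_0[where F = "\<lambda>t. - f' t"])
    (auto intro!: derivative_eq_intros simp: periodic)

lemma P1_nonpos: "P1 \<le> 0"
proof -
  have "((\<lambda>t. f t / sqrt A) has_integral 0) {0..2*pi}"
    using has_integral_divide[OF has_integral_f] by simp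
  then show ?thesis
    by (rule has_integral_le[OF has_integral_basis(5)]) (rule f_div_U_le)
qed

text \<open>The derivative of f f' U has mean zero, which identifies 2 J2 - B^2 J0 with the integral
  of (f'^2 / 2)(f / U). By \<open>f_div_U_le\<close> this is at most the same integral with sqrt A
  in place of U, and that one vanishes because f'^2 f is the derivative of -f'^3 / 3.\<close>

lemma J2_le: "2 * J2 \<le> B\<^sup>2 * J0"
proof -
  have "((\<lambda>t. (f' t * f' t + f t * - f t) * U t + f t * (f' t * (f' t / (2 * U t)))) has_integral 0) {0..2*pi}"
    by (rule periodic_derivative_has_integral_0[where F = "\<lambda>t. f t * f' t * U t"])
      (auto intro!: derivative_eq_intros simp: periodic[symmetric] algebra_simps)
  moreover have "((\<lambda>t. B\<^sup>2 * U t - 2 * (U t * (f t)\<^sup>2)) has_integral B\<^sup>2 * J0 - 2 * J2) {0..2*pi}"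
    by (intro has_integral_diff has_integral_mult_right has_integral_basis)
  ultimately have "((\<lambda>t. ((f' t * f' t + f t * - f t) * U t + f t * (f' t * (f' t / (2 * U t))))
      - (B\<^sup>2 * U t - 2 * (U t * (f t)\<^sup>2))) has_integral 0 - (B\<^sup>2 * J0 - 2 * J2)) {0..2*pi}"
    by (rule has_integral_diff)
  moreover have "((f' t * f' t + f t * - f t) * U t + f t * (f' t * (f' t / (2 * U t))))
      - (B\<^sup>2 * U t - 2 * (U t * (f t)\<^sup>2)) = f' t * f' t / 2 * (f t / U t)" for t
  proof -
    have "(f' t * f' t + f t * - f t) * U t = B\<^sup>2 * U t - 2 * (U t * (f t)\<^sup>2)"
      unfolding f'_sq by (simp add: algebra_simps power2_eq_square)
    then show ?thesis by simp
  qed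
  ultimately have I: "((\<lambda>t. f' t * f' t / 2 * (f t / U t)) has_integral 2 * J2 - B\<^sup>2 * J0) {0..2*pi}"
    by simp
  have "((\<lambda>t. f' t * f' t * f t) has_integral 0) {0..2*pi}"
    by (rule periodic_derivative_has_integral_0[where F = "\<lambda>t. - ((f' t) ^ 3 / 3)"])
      (auto intro!: derivative_eq_intros simp: periodic power2_eq_square)
  from has_integral_divide[OF this, of "2 * sqrt A"]
  have "((\<lambda>t. f' t * f' t / 2 * (f t / sqrt A)) has_integral 0) {0..2*pi}"
    by simp
  then have "2 * J2 - B\<^sup>2 * J0 \<le> 0"
    by (rule has_integral_le[OF I]) (intro mult_left_mono f_div_U_le, simp)
  then show ?thesis by simp
qed

text \<open>By \<open>J2_eq\<close> this is 5 J2 - 2 B^2 J0. It is the factor of 2 \<rho> B^2 in B^4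
  times the averaged drift at X^2 = B^2, the least favourable value of X^2 for the
  \<rho>-part.\<close>

definition D :: real where "D = B\<^sup>2 * J0 - 2 * A * J1"

lemma J1_eq': "3 * J1 = B\<^sup>2 * P0 + A * P1"
  using J1_eq P2_eq by algebra

lemma D_eq: "3 * D = A * B\<^sup>2 * P0 + (B\<^sup>2 - 2) * P1"
  unfolding D_def using J0_eq J1_eq' A_sq_B by algebra

text \<open>Here A + f < 2 A, and 3/2 is a rational bound for sqrt 2.\<close>

lemma U_le: "U t \<le> 3 / 2 * sqrt A"
proof -
  have "U t \<le> sqrt (9 / 4 * A)"
    unfolding U_def using abs_f_le[of t] B_less_A by (intro real_sqrt_le_mono) linarith
  also have "sqrt (9 / 4 * A) = sqrt ((3 / 2)\<^sup>2) * sqrt A"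
    by (simp only: real_sqrt_mult[symmetric]) (simp add: power2_eq_square)
  finally show ?thesis by simp
qed

lemma P0_ge: "P0 \<ge> 3 / sqrt A"
proof -
  have "((\<lambda>t. 2 / 3 / sqrt A) has_integral 2 * pi * (2 / 3 / sqrt A)) {0..2*pi}"
    by (rule has_integral_const_2pi)
  then have "2 * pi * (2 / 3 / sqrt A) \<le> P0"
  proof (rule has_integral_le[OF _ has_integral_basis(4)])
    show "2 / 3 / sqrt A \<le> 1 / U t" for t
      using U_le[of t] U_pos[of t] A_pos by (simp add: field_simps)
  qed
  moreover have "3 / sqrt A \<le> 2 * pi * (2 / 3 / sqrt A)"
    using pi_gt3 A_pos by (simp add: field_simps)
  ultimately show ?thesis by linarith
qed

text \<open>By \<open>U_le\<close>, U = U^2 / U is at least (2/3)(A + f) / sqrt A, where f has mean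
  zero; then pi > 3 gives the constant.\<close>

lemma J0_ge: "J0 \<ge> 4 * sqrt A"
proof -
  have "((\<lambda>t. 2 / 3 / sqrt A * (A + f t)) has_integral 2 / 3 / sqrt A * (2 * pi * A + 0)) {0..2*pi}"
    by (intro has_integral_mult_right has_integral_add has_integral_f has_integral_const_2pi)
  then have "2 / 3 / sqrt A * (2 * pi * A + 0) \<le> J0"
  proof (rule has_integral_le[OF _ has_integral_basis(1)])
    fix t
    have "2 / 3 / sqrt A * (A + f t) = 2 / 3 / sqrt A * U t * U t"
      by (simp add: U_sq[symmetric] power2_eq_square)
    also have "\<dots> \<le> 1 * U t"
      using U_le[of t] U_pos[of t] A_pos by (intro mult_right_mono) (auto simp: field_simps)
    finally show "2 / 3 / sqrt A * (A + f t) \<le> U t" by simp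
  qed
  moreover have "2 / 3 / sqrt A * (2 * pi * A + 0) = 4 / 3 * (pi * (A / sqrt A))"
    by simp
  then have "2 / 3 / sqrt A * (2 * pi * A + 0) = 4 / 3 * (pi * sqrt A)"
    using A_pos by (simp only: real_div_sqrt less_imp_le)
  moreover have "3 * sqrt A \<le> pi * sqrt A" using pi_gt3 A_pos by (intro mult_right_mono) auto
  ultimately show ?thesis by linarith
qed

text \<open>Eliminating \<open>J2\<close> between \<open>J2_eq\<close> and \<open>J2_le\<close>
  gives the sign. The expression is the coefficient of 2 \<rho> X^2 in
  \<open>averaged_drift_eq\<close>, so X^2 = B^2 is the worst case there.\<close>

lemma N_nonpos: "B\<^sup>2 * J0 - 4 * A * J1 \<le> 0"
  using J2_le J2_eq by (simp add: algebra_simps)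

lemma J1_nonneg: "J1 \<ge> 0"
proof -
  have "0 \<le> B\<^sup>2 * J0" using J0_ge A_pos by (meson mult_nonneg_nonneg order_trans zero_le_power2 real_sqrt_ge_zero less_imp_le zero_le_numeral)
  then have "0 \<le> A * J1" using N_nonpos by linarith
  then show ?thesis using A_pos by (simp add: zero_le_mult_iff)
qed

text \<open>This comparison is the source of the factor 3 in the hypothesis: in the drift the a-term
  costs at most 6 |a| B^2 (B J1), against a gain of 2 \<rho> B^2 D. The difference factors through A
  - B because A^2 - B^2 = 1, and the other factor has a sign since P0 is nonnegative and P1
  nonpositive.\<close>

lemma B_J1_le_D: "B * J1 \<le> D"
proof -
  have "3 * (D - B * J1) = (A - B) * (B\<^sup>2 * P0 + (2 * A + 3 * B) * - P1)"
    using D_eq J1_eq' A_sq_B by algebra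
  moreover have "0 \<le> P0" using P0_ge A_pos by (meson divide_nonneg_nonneg less_imp_le order_trans real_sqrt_ge_zero zero_le_numeral)
  then have "0 \<le> (A - B) * (B\<^sup>2 * P0 + (2 * A + 3 * B) * - P1)"
    using B_less_A B_nonneg P1_nonpos by (intro mult_nonneg_nonneg add_nonneg_nonneg) auto
  ultimately have "0 \<le> 3 * (D - B * J1)" by (simp only:)
  then show ?thesis by simp
qed

text \<open>Small and large orbits are separated. For B^2 \<le> 2 the P1 term in \<open>D_eq\<close>
  has the good sign and \<open>P0_ge\<close> suffices. For larger B the J1 term in \<open>D\<close>
  is absorbed by \<open>B_J1_le_D\<close>, and \<open>J0_ge\<close> gives the size.\<close>

lemma D_ge: "B\<^sup>2 * sqrt A \<le> D"
proof (cases "B\<^sup>2 \<le> 2")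
  case True
  then have "0 \<le> (B\<^sup>2 - 2) * P1" using P1_nonpos by (intro mult_nonpos_nonpos) auto
  moreover have "B\<^sup>2 * A * (3 / sqrt A) \<le> B\<^sup>2 * A * P0"
    using P0_ge A_pos by (intro mult_left_mono) auto
  moreover have "B\<^sup>2 * A * (3 / sqrt A) = 3 * (B\<^sup>2 * (A / sqrt A))" by simp
  moreover have "A / sqrt A = sqrt A" using A_pos by (simp add: real_div_sqrt)
  ultimately show ?thesis using D_eq by (simp add: mult_ac)
next
  case False
  \<comment> \<open>With A^2 = 1 + B^2 this reads 4 \<le> 5 B^2, which B^2 > 2 covers amply.\<close>
  have "(2 * A)\<^sup>2 \<le> (3 * B)\<^sup>2" using False A_sq_B by (simp add: power_mult_distrib)
  then have AB: "2 * A \<le> 3 * B" by (rule power2_le_imp_le) (simp add: B_nonneg)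
  have B: "B > 0" using False B_nonneg by (cases "B = 0") auto
  have D0: "D \<ge> 0" using B_J1_le_D J1_nonneg B_nonneg by (meson mult_nonneg_nonneg order_trans)
  have "B ^ 3 * (4 * sqrt A) \<le> B ^ 3 * J0"
    using J0_ge B by (intro mult_left_mono) auto
  also have "B ^ 3 * J0 = B * D + 2 * A * (B * J1)"
    unfolding D_def by algebra
  also have "\<dots> \<le> B * D + 2 * A * D"
    using B_J1_le_D A_pos by (intro add_left_mono mult_left_mono) auto
  also have "\<dots> \<le> B * D + 3 * B * D" using AB D0 by (intro add_left_mono mult_right_mono) auto
  finally have "(4 * B) * (B\<^sup>2 * sqrt A) \<le> (4 * B) * D"
    by (simp add: power2_eq_square power3_eq_cube mult_ac)
  then show ?thesis using B by (simp only: mult_le_cancel_left_pos mult_pos_pos zero_less_numeral)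
qed

section \<open>Evaluation and lower bound of the averaged drift\<close>

lemma has_integral_U_f': "((\<lambda>t. U t * f' t) has_integral 0) {0..2*pi}"
proof -
  have "((\<lambda>t. 2 / 3 * (3 * (U t)\<^sup>2 * (f' t / (2 * U t)))) has_integral 0) {0..2*pi}"
    by (rule periodic_derivative_has_integral_0[where F = "\<lambda>t. 2 / 3 * (U t) ^ 3"])
      (auto intro!: derivative_eq_intros simp: periodic)
  moreover have "2 / 3 * (3 * (U t)\<^sup>2 * (f' t / (2 * U t))) = U t * f' t" for t
    using U_pos[of t] by (simp add: power2_eq_square)
  ultimately show ?thesis by simp
qed

text \<open>Writing f = U^2 - A turns the integrand into U^3 f' - A U f', and both terms are exact
  because f' = 2 U U'. Together with \<open>has_integral_U_f'\<close> this removes the cross terms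
  from the averaged drift.\<close>

lemma has_integral_U_f_f': "((\<lambda>t. U t * f t * f' t) has_integral 0) {0..2*pi}"
proof -
  have "((\<lambda>t. 2 / 5 * (5 * (U t) ^ 4 * (f' t / (2 * U t)))) has_integral 0) {0..2*pi}"
    by (rule periodic_derivative_has_integral_0[where F = "\<lambda>t. 2 / 5 * (U t) ^ 5"])
      (auto intro!: derivative_eq_intros simp: periodic)
  then have "((\<lambda>t. 2 / 5 * (5 * (U t) ^ 4 * (f' t / (2 * U t))) - A * (U t * f' t)) has_integral 0 - A * 0) {0..2*pi}"
    by (intro has_integral_diff has_integral_mult_right has_integral_U_f')
  moreover have "2 / 5 * (5 * (U t) ^ 4 * (f' t / (2 * U t))) - A * (U t * f' t) = U t * f t * f' t" for t
  proof -
    have "2 / 5 * (5 * (U t) ^ 4 * (f' t / (2 * U t))) = (U t)\<^sup>2 * U t * f' t"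
      using U_pos[of t] by (simp add: power2_eq_square power4_eq_xxxx)
    then show ?thesis unfolding U_sq by (simp add: algebra_simps)
  qed
  ultimately show ?thesis by simp
qed

text \<open>In the orbit's own phase B^2 cos t = X f + Y f', so the factor B^4 makes the kernel
  polynomial in f and f'. Terms odd in f' integrate to zero, and \<open>J2_eq\<close> eliminates
  \<open>J2\<close>. For B = 0 the identity is empty.\<close>

lemma averaged_drift_eq:
  assumes T: "((\<lambda>t. U t * (\<rho> + 5 * \<rho> * cos (2 * t) + 6 * a * cos t)) has_integral T) {0..2*pi}"
  shows "B ^ 4 * T = 2 * \<rho> * X\<^sup>2 * (B\<^sup>2 * J0 - 4 * A * J1) + 4 * A * \<rho> * B\<^sup>2 * J1 + 6 * a * B\<^sup>2 * X * J1"
proof -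
  have "((\<lambda>t. 10 * \<rho> * (X\<^sup>2 * (U t * (f t)\<^sup>2) + Y\<^sup>2 * (B\<^sup>2 * U t - U t * (f t)\<^sup>2) + 2 * X * Y * (U t * f t * f' t))
      - 4 * \<rho> * B ^ 4 * U t + 6 * a * B\<^sup>2 * (X * (U t * f t) + Y * (U t * f' t))) has_integral
      10 * \<rho> * (X\<^sup>2 * J2 + Y\<^sup>2 * (B\<^sup>2 * J0 - J2) + 2 * X * Y * 0)
      - 4 * \<rho> * B ^ 4 * J0 + 6 * a * B\<^sup>2 * (X * J1 + Y * 0)) {0..2*pi}"
    by (intro has_integral_diff has_integral_add has_integral_mult_right has_integral_basis
        has_integral_U_f' has_integral_U_f_f')
  moreover have "B ^ 4 * (U t * (\<rho> + 5 * \<rho> * cos (2 * t) + 6 * a * cos t)) =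
      10 * \<rho> * (X\<^sup>2 * (U t * (f t)\<^sup>2) + Y\<^sup>2 * (B\<^sup>2 * U t - U t * (f t)\<^sup>2) + 2 * X * Y * (U t * f t * f' t))
      - 4 * \<rho> * B ^ 4 * U t + 6 * a * B\<^sup>2 * (X * (U t * f t) + Y * (U t * f' t))" for t
  proof -
    have c: "B\<^sup>2 * cos t = X * f t + Y * f' t"
      unfolding B_sq f_def f'_def by algebra
    have "B ^ 4 * (U t * (\<rho> + 5 * \<rho> * cos (2 * t) + 6 * a * cos t)) =
        U t * (10 * \<rho> * (B\<^sup>2 * cos t)\<^sup>2 - 4 * \<rho> * B ^ 4 + 6 * a * B\<^sup>2 * (B\<^sup>2 * cos t))"
      unfolding cos_double_cos by algebra
    also have "(B\<^sup>2 * cos t)\<^sup>2 = X\<^sup>2 * (f t)\<^sup>2 + Y\<^sup>2 * (B\<^sup>2 - (f t)\<^sup>2) + 2 * X * Y * (f t * f' t)"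
      unfolding c f'_sq[of t, symmetric] by algebra
    finally show ?thesis unfolding c by algebra
  qed
  ultimately have "B ^ 4 * T = 10 * \<rho> * (X\<^sup>2 * J2 + Y\<^sup>2 * (B\<^sup>2 * J0 - J2) + 2 * X * Y * 0)
      - 4 * \<rho> * B ^ 4 * J0 + 6 * a * B\<^sup>2 * (X * J1 + Y * 0)"
    by (intro has_integral_eq_cong[OF has_integral_mult_right[OF T]])
  then show ?thesis using J2_eq B_sq by algebra
qed

text \<open>The \<rho>-part is affine in X^2 with nonpositive slope by \<open>N_nonpos\<close>, so
  X^2 may be replaced by B^2, which leaves 2 \<rho> B^2 D. The a-part is controlled by |X| \<le> B
  and \<open>B_J1_le_D\<close>, and \<open>D_ge\<close> concludes.\<close>

lemma averaged_drift_ge: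
  assumes T: "((\<lambda>t. U t * (\<rho> + 5 * \<rho> * cos (2 * t) + 6 * a * cos t)) has_integral T) {0..2*pi}"
    and \<rho>: "\<rho> > 3 * \<bar>a\<bar>"
  shows "2 * (\<rho> - 3 * \<bar>a\<bar>) * sqrt A \<le> T"
proof (cases "B = 0")
  case True
  \<comment> \<open>Division by B^4 is impossible here; the orbit is the equilibrium U = 1 and the
    drift is computed directly as 2 pi \<rho>.\<close>
  then have XY: "X = 0" "Y = 0" using B_sq by (auto simp: sum_power2_eq_zero_iff)
  then have "A = 1" using A_sq A_pos by (simp add: power2_eq_1_iff)
  then have U: "U t = 1" for t unfolding U_def f_def by (simp add: XY \<open>A = 1\<close>)
  have "((\<lambda>t. 5 * \<rho> * cos (2 * t) + 6 * a * cos t) has_integral 0) {0..2*pi}"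
    by (rule periodic_derivative_has_integral_0[where F = "\<lambda>t. 5 / 2 * \<rho> * sin (2 * t) + 6 * a * sin t"])
      (auto intro!: derivative_eq_intros simp: cos_double power2_eq_square sin_double)
  then have "((\<lambda>t. \<rho> + (5 * \<rho> * cos (2 * t) + 6 * a * cos t)) has_integral 2 * pi * \<rho> + 0) {0..2*pi}"
    by (intro has_integral_add has_integral_const_2pi) auto
  then have "T = 2 * pi * \<rho>"
    by (intro has_integral_eq_cong[OF T]) (auto simp: U add.assoc)
  moreover have "2 * \<rho> \<le> 2 * pi * \<rho>" using pi_gt3 \<rho> by (intro mult_right_mono) auto
  ultimately show ?thesis using \<open>A = 1\<close> by simp
next
  case False
  then have B: "B > 0" using B_nonneg by simp
  have XB: "\<bar>X\<bar> \<le> B" by (rule power2_le_imp_le) (simp_all add: B_sq B_nonneg)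
  have "X\<^sup>2 \<le> B\<^sup>2" using B_sq by simp
  then have "2 * \<rho> * (B\<^sup>2 * (B\<^sup>2 * J0 - 4 * A * J1)) \<le> 2 * \<rho> * (X\<^sup>2 * (B\<^sup>2 * J0 - 4 * A * J1))"
    using N_nonpos \<rho> by (intro mult_left_mono mult_right_mono_neg) auto
  moreover have "\<bar>a * X\<bar> \<le> \<bar>a\<bar> * B" using XB by (simp add: abs_mult mult_left_mono)
  then have "6 * B\<^sup>2 * J1 * (- (\<bar>a\<bar> * B)) \<le> 6 * B\<^sup>2 * J1 * (a * X)"
    using J1_nonneg by (intro mult_left_mono) auto
  moreover have "6 * B\<^sup>2 * \<bar>a\<bar> * (B * J1) \<le> 6 * B\<^sup>2 * \<bar>a\<bar> * D"
    using B_J1_le_D by (intro mult_left_mono) auto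
  moreover have "2 * (\<rho> - 3 * \<bar>a\<bar>) * B\<^sup>2 * (B\<^sup>2 * sqrt A) \<le> 2 * (\<rho> - 3 * \<bar>a\<bar>) * B\<^sup>2 * D"
    using D_ge \<rho> by (intro mult_left_mono) auto
  moreover have "2 * (\<rho> - 3 * \<bar>a\<bar>) * B\<^sup>2 * D = 2 * \<rho> * (B\<^sup>2 * (B\<^sup>2 * J0 - 4 * A * J1))
      + 4 * A * \<rho> * B\<^sup>2 * J1 - 6 * B\<^sup>2 * \<bar>a\<bar> * D"
    unfolding D_def by algebra
  ultimately have "B ^ 4 * (2 * (\<rho> - 3 * \<bar>a\<bar>) * sqrt A) \<le> B ^ 4 * T"
    unfolding averaged_drift_eq[OF T] by (simp add: algebra_simps power2_eq_square power4_eq_xxxx)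
  then show ?thesis using B by simp
qed

end

section \<open>Forced solutions on the whole line\<close>

text \<open>The quantity is four times the mechanical energy; the terms of the potential cancel and
  the power of the forcing remains. Working at a single point makes this usable both on the whole
  line and on a bounded interval.\<close>

lemma DERIV_pinney_energy:
  fixes u v :: "real \<Rightarrow> real"
  assumes "(u has_real_derivative v t) (at t)"
    and "(v has_real_derivative (1 / (u t) ^ 3 - u t) / 4 + q) (at t)"
    and "u t > 0"
  shows "((\<lambda>s. 2 * (v s)\<^sup>2 + (u s)\<^sup>2 / 2 + 1 / (2 * (u s)\<^sup>2)) has_real_derivative 4 * v t * q) (at t)"
proof -
  have "((\<lambda>t. 2 * (v t)\<^sup>2 + (u t)\<^sup>2 / 2 + 1 / (2 * (u t)\<^sup>2)) has_real_derivative
      4 * v t * ((1 / (u t) ^ 3 - u t) / 4 + q) + u t * v t - v t * (1 / (u t) ^ 3)) (at t)"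
    by (rule derivative_eq_intros assms refl | use assms(3) in
      \<open>simp add: power2_eq_square power3_eq_cube divide_simps\<close>)+
  moreover have "4 * v t * ((w - u t) / 4 + q) + u t * v t - v t * w = 4 * v t * q" for w
    by (simp add: field_simps)
  ultimately show ?thesis by metis
qed

locale pinney_solution =
  fixes u v q :: "real \<Rightarrow> real"
  assumes DERIV_u [derivative_intros]: "(u has_real_derivative v t) (at t)"
    and DERIV_v [derivative_intros]: "(v has_real_derivative (1 / (u t) ^ 3 - u t) / 4 + q t) (at t)"
    and u_pos: "u t > 0"
begin

section \<open>Slow variables of a forced solution\<close>

definition A :: "real \<Rightarrow> real" where
  "A t = 2 * (v t)\<^sup>2 + (u t)\<^sup>2 / 2 + 1 / (2 * (u t)\<^sup>2)"
text \<open>Without forcing the pair (u^2 - A, 2 u v) rotates with unit speed; \<open>X\<close> and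
  \<open>Y\<close> are its coordinates in the co-rotating frame.\<close>

definition X :: "real \<Rightarrow> real" where
  "X t = ((u t)\<^sup>2 - A t) * cos t - 2 * u t * v t * sin t"
definition Y :: "real \<Rightarrow> real" where
  "Y t = ((u t)\<^sup>2 - A t) * sin t + 2 * u t * v t * cos t"

lemma u_sq: "(u t)\<^sup>2 = A t + (X t * cos t + Y t * sin t)"
proof -
  have "X t * cos t + Y t * sin t = ((u t)\<^sup>2 - A t) * ((cos t)\<^sup>2 + (sin t)\<^sup>2)"
    unfolding X_def Y_def by algebra
  then show ?thesis by simp
qed

text \<open>Rotation preserves the norm of (u^2 - A, 2 u v), and 2 A - u^2 - 4 v^2 = 1 / u^2. Hence
  the values at any time are parameters of an unforced orbit.\<close>

lemma A_sq: "(A t)\<^sup>2 = 1 + (X t)\<^sup>2 + (Y t)\<^sup>2"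
proof -
  have "(X t)\<^sup>2 + (Y t)\<^sup>2 = (((u t)\<^sup>2 - A t)\<^sup>2 + (2 * u t * v t)\<^sup>2) * ((cos t)\<^sup>2 + (sin t)\<^sup>2)"
    unfolding X_def Y_def by algebra
  also have "\<dots> = (A t)\<^sup>2 - (u t)\<^sup>2 * (2 * A t - (u t)\<^sup>2 - 4 * (v t)\<^sup>2)"
    unfolding sin_cos_squared_add2 by algebra
  also have "2 * A t - (u t)\<^sup>2 - 4 * (v t)\<^sup>2 = 1 / (u t)\<^sup>2"
    unfolding A_def by (simp add: field_simps)
  also have "(u t)\<^sup>2 * (1 / (u t)\<^sup>2) = 1"
    using u_pos[of t] by simp
  finally show ?thesis by simp
qed

lemma A_ge_1: "A t \<ge> 1"
proof (rule power2_le_imp_le)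
  show "1\<^sup>2 \<le> (A t)\<^sup>2" by (simp add: A_sq)
  show "0 \<le> A t" unfolding A_def by simp
qed

lemma abs_v_le: "\<bar>v t\<bar> \<le> sqrt (A t)"
proof -
  have "(v t)\<^sup>2 \<le> A t" unfolding A_def by simp
  then show ?thesis using real_sqrt_le_mono by fastforce
qed

lemma u_le: "u t \<le> 2 * sqrt (A t)"
proof -
  have "(u t)\<^sup>2 \<le> 4 * A t" unfolding A_def by simp
  then have "(u t)\<^sup>2 \<le> (2 * sqrt (A t))\<^sup>2" using A_ge_1[of t] by (simp add: power_mult_distrib)
  then show ?thesis by (rule power2_le_imp_le) (use A_ge_1[of t] in simp)
qed

lemma DERIV_A [derivative_intros]: "(A has_real_derivative 4 * v t * q t) (at t)"
  unfolding A_def[abs_def] by (rule DERIV_pinney_energy[OF DERIV_u DERIV_v u_pos])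

text \<open>The singular term multiplied by u becomes 1 / u^2 and is absorbed in A. With
  \<open>DERIV_u_sq_minus_A\<close> this is the rotation equation plus forcing terms.\<close>

lemma DERIV_uv: "((\<lambda>t. 2 * u t * v t) has_real_derivative A t - (u t)\<^sup>2 + 2 * u t * q t) (at t)"
proof -
  have "((\<lambda>t. 2 * u t * v t) has_real_derivative
      2 * v t * v t + 2 * u t * ((1 / (u t) ^ 3 - u t) / 4 + q t)) (at t)"
    by (auto intro!: derivative_eq_intros)
  moreover have "2 * v t * v t + 2 * u t * ((1 / (u t) ^ 3 - u t) / 4 + q t) = A t - (u t)\<^sup>2 + 2 * u t * q t"
  proof -
    have "u t * (1 / (u t) ^ 3) = 1 / (u t)\<^sup>2"
      using u_pos[of t] by (simp add: power2_eq_square power3_eq_cube)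
    moreover have "2 * v t * v t + 2 * u t * ((w - u t) / 4 + q t)
        = 2 * (v t)\<^sup>2 + (u t)\<^sup>2 / 2 + (u t * w) / 2 - (u t)\<^sup>2 + 2 * u t * q t" for w
      by (simp add: field_simps power2_eq_square)
    ultimately show ?thesis unfolding A_def by simp
  qed
  ultimately show ?thesis by simp
qed

lemma DERIV_u_sq_minus_A: "((\<lambda>t. (u t)\<^sup>2 - A t) has_real_derivative 2 * u t * v t - 4 * v t * q t) (at t)"
  by (auto intro!: derivative_eq_intros)

text \<open>The rotation terms cancel and only terms proportional to the forcing survive, which
  makes \<open>X\<close> slow; \<open>Y\<close> behaves alike.\<close>

lemma DERIV_X: "(X has_real_derivative q t * (- 4 * v t * cos t - 2 * u t * sin t)) (at t)"
  unfolding X_def[abs_def]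
  by (rule DERIV_cong[OF DERIV_diff[OF DERIV_mult[OF DERIV_u_sq_minus_A DERIV_cos]
          DERIV_mult[OF DERIV_uv DERIV_sin]]])
    (simp add: algebra_simps)

lemma DERIV_Y [derivative_intros]:
  "(Y has_real_derivative q t * (- 4 * v t * sin t + 2 * u t * cos t)) (at t)"
  unfolding Y_def[abs_def]
  by (rule DERIV_cong[OF DERIV_add[OF DERIV_mult[OF DERIV_u_sq_minus_A DERIV_sin]
          DERIV_mult[OF DERIV_uv DERIV_cos]]])
    (simp add: algebra_simps)

section \<open>Distance from the unforced orbit over one period\<close>

lemma increment_le:
  assumes "\<And>s. s \<in> {0..2*pi} \<Longrightarrow> (F has_real_derivative G s) (at s)"
    and "\<And>s. s \<in> {0..2*pi} \<Longrightarrow> \<bar>G s\<bar> \<le> c" and t: "t \<in> {0..2*pi}"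
  shows "\<bar>F t - F 0\<bar> \<le> 7 * c"
proof -
  have "norm (F t - F 0) \<le> c * norm (t - 0)"
    by (rule field_differentiable_bound[of "{0..2*pi}" F G])
      (use assms in \<open>auto intro: has_field_derivative_at_within\<close>)
  \<comment> \<open>7 is an integer above the period 2 pi.\<close>
  also have "\<dots> \<le> c * 7"
    using assms(2)[OF t] t pi_less_4 pi_approx by (intro mult_left_mono) auto
  finally show ?thesis by simp
qed

text \<open>Freezing the variables at time 0 gives the unforced orbit with the same initial position
  and velocity, with which the forced solution is compared.\<close>

sublocale orbit: unperturbed_orbit "A 0" "X 0" "Y 0"
  using A_ge_1[of 0] A_sq[of 0] by unfold_locales auto

context
  fixes \<eta> :: real
  assumes q_le: "\<bar>q t\<bar> \<le> \<eta>" and \<eta>_small: "14 * \<eta> \<le> 1"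
begin

text \<open>The derivative 2 v q / sqrt A of sqrt A is at most 2 \<eta> in modulus whatever the size
  of the orbit. Over a period the change is at most 14 \<eta> \<le> 1 \<le> sqrt (A 0).\<close>

lemma sqrt_A_le:
  assumes "t \<in> {0..2*pi}"
  shows "sqrt (A t) \<le> 2 * sqrt (A 0)"
proof -
  have "\<bar>sqrt (A t) - sqrt (A 0)\<bar> \<le> 7 * (2 * \<eta>)"
  proof (rule increment_le[OF _ _ assms])
    fix s
    have A: "A s > 0" using A_ge_1[of s] by simp
    show "((\<lambda>t. sqrt (A t)) has_real_derivative inverse (sqrt (A s)) / 2 * (4 * v s * q s)) (at s)"
      using A by (intro DERIV_chain2[where f = sqrt and g = A] DERIV_real_sqrt DERIV_A)
    have "\<bar>v s\<bar> * \<bar>q s\<bar> \<le> sqrt (A s) * \<eta>"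
      using abs_v_le q_le A by (intro mult_mono) auto
    then show "\<bar>inverse (sqrt (A s)) / 2 * (4 * v s * q s)\<bar> \<le> 2 * \<eta>"
      using A by (simp add: abs_mult field_simps)
  qed
  moreover have "1 \<le> sqrt (A 0)" using A_ge_1 by simp
  ultimately show ?thesis using \<eta>_small by linarith
qed

text \<open>The derivatives are linear in u and v, hence of order sqrt (A 0) only. With |v| \<le> 2
  sqrt (A 0) and u \<le> 4 sqrt (A 0) they are at most 8 and 16 times \<eta> sqrt (A 0); the factor
  7 gives 56 and 112.\<close>

lemma increments:
  assumes t: "t \<in> {0..2*pi}"
  shows "\<bar>A t - A 0\<bar> \<le> 56 * \<eta> * sqrt (A 0)" (is ?a)
    and "\<bar>X t - X 0\<bar> \<le> 112 * \<eta> * sqrt (A 0)" (is ?x)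
    and "\<bar>Y t - Y 0\<bar> \<le> 112 * \<eta> * sqrt (A 0)" (is ?y)
proof -
  have \<eta>0: "\<eta> \<ge> 0" using q_le[of 0] by linarith
  have v: "\<bar>v s\<bar> \<le> 2 * sqrt (A 0)" and u: "\<bar>u s\<bar> \<le> 4 * sqrt (A 0)" if "s \<in> {0..2*pi}" for s
    using sqrt_A_le[OF that] abs_v_le[of s] u_le[of s] u_pos[of s] by linarith+
  have vx: "\<bar>v s * x\<bar> \<le> 2 * sqrt (A 0)" and ux: "\<bar>u s * x\<bar> \<le> 4 * sqrt (A 0)"
    if "s \<in> {0..2*pi}" "\<bar>x\<bar> \<le> 1" for s x
    using mult_mono[OF v[OF that(1)] that(2)] mult_mono[OF u[OF that(1)] that(2)] A_ge_1[of 0]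
    by (simp_all add: abs_mult)
  have prod: "\<bar>q s * z\<bar> \<le> \<eta> * c" if "\<bar>z\<bar> \<le> c" for s z c
    using mult_mono[OF q_le that] \<eta>0 by (simp add: abs_mult)
  have "\<bar>A t - A 0\<bar> \<le> 7 * (\<eta> * (8 * sqrt (A 0)))"
  proof (rule increment_le[OF DERIV_A _ t])
    fix s assume "s \<in> {0..2*pi}"
    then have "\<bar>4 * v s\<bar> \<le> 8 * sqrt (A 0)" using v by (simp add: abs_mult)
    then show "\<bar>4 * v s * q s\<bar> \<le> \<eta> * (8 * sqrt (A 0))" using prod by (metis mult.commute)
  qed
  then show ?a by simp
  have "\<bar>X t - X 0\<bar> \<le> 7 * (\<eta> * (16 * sqrt (A 0)))"
  proof (rule increment_le[OF DERIV_X prod t])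
    fix s assume "s \<in> {0..2*pi}"
    from vx[OF this, of "cos s"] ux[OF this, of "sin s"]
    show "\<bar>- 4 * v s * cos s - 2 * u s * sin s\<bar> \<le> 16 * sqrt (A 0)" by simp
  qed
  then show ?x by simp
  have "\<bar>Y t - Y 0\<bar> \<le> 7 * (\<eta> * (16 * sqrt (A 0)))"
  proof (rule increment_le[OF DERIV_Y prod t])
    fix s assume "s \<in> {0..2*pi}"
    from vx[OF this, of "sin s"] ux[OF this, of "cos s"]
    show "\<bar>- 4 * v s * sin s + 2 * u s * cos s\<bar> \<le> 16 * sqrt (A 0)" by simp
  qed
  then show ?y by simp
qed

text \<open>The increments add up to 56 + 112 + 112 = 280. The passage from squares to u uses (u -
  U)^2 \<le> |u - U| (u + U) = |u^2 - U^2|, which stays uniform when u or U comes close to 0, at the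
  price of a square root of \<eta>.\<close>

lemma abs_u_minus_orbit_le:
  assumes t: "t \<in> {0..2*pi}"
  shows "\<bar>u t - orbit.U t\<bar> \<le> sqrt (280 * \<eta>) * sqrt (A 0)"
proof -
  have "\<bar>(X t - X 0) * cos t\<bar> \<le> 112 * \<eta> * sqrt (A 0)" "\<bar>(Y t - Y 0) * sin t\<bar> \<le> 112 * \<eta> * sqrt (A 0)"
    using mult_mono[OF increments(2)[OF t] abs_cos_le_one] mult_mono[OF increments(3)[OF t] abs_sin_le_one]
      increments(2)[OF t] by (simp_all add: abs_mult)
  moreover have "(u t)\<^sup>2 - (orbit.U t)\<^sup>2 = (A t - A 0) + (X t - X 0) * cos t + (Y t - Y 0) * sin t"
    unfolding orbit.U_sq orbit.f_def u_sq[of t] by (simp add: algebra_simps)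
  ultimately have "\<bar>(u t)\<^sup>2 - (orbit.U t)\<^sup>2\<bar> \<le> 280 * \<eta> * sqrt (A 0)"
    using increments(1)[OF t] by linarith
  also have "\<dots> \<le> 280 * \<eta> * A 0"
  proof (rule mult_left_mono)
    show "sqrt (A 0) \<le> A 0" using A_ge_1[of 0] by (simp add: real_le_lsqrt power2_eq_square)
    show "0 \<le> 280 * \<eta>" using q_le[of 0] by simp
  qed
  finally have le: "\<bar>(u t)\<^sup>2 - (orbit.U t)\<^sup>2\<bar> \<le> 280 * \<eta> * A 0" .
  have "(u t - orbit.U t)\<^sup>2 \<le> \<bar>u t - orbit.U t\<bar> * \<bar>u t + orbit.U t\<bar>"
    unfolding power2_eq_square abs_mult_self[symmetric, of "u t - orbit.U t"]
    using u_pos[of t] orbit.U_pos[of t] by (intro mult_left_mono) auto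
  also have "\<dots> = \<bar>(u t)\<^sup>2 - (orbit.U t)\<^sup>2\<bar>"
    by (simp add: abs_mult[symmetric] power2_eq_square algebra_simps)
  finally have "\<bar>u t - orbit.U t\<bar> \<le> sqrt (280 * \<eta> * A 0)"
    using le by (intro real_le_rsqrt) simp
  then show ?thesis by (simp add: real_sqrt_mult)
qed

end

text \<open>Adding \<open>4 * q t * u t * sin t\<close> to \<open>Y\<close> removes the velocity from its derivative.\<close>

lemma drift_has_integral:
  assumes q: "\<And>t. q t = e * (a + \<rho> * cos t)"
  shows "((\<lambda>t. e * (u t * (\<rho> + 5 * \<rho> * cos (2 * t) + 6 * a * cos t))) has_integral
    2 * u (2 * pi) * v (2 * pi) - 2 * u 0 * v 0) {0..2*pi}"
proof -
  define F where "F t = Y t + 4 * (e * (a + \<rho> * cos t)) * (u t * sin t)" for t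
  have "(F has_real_derivative e * (u t * (\<rho> + 5 * \<rho> * cos (2 * t) + 6 * a * cos t))) (at t)" for t
  proof -
    have "(F has_real_derivative q t * (- 4 * v t * sin t + 2 * u t * cos t)
        + (4 * (e * (\<rho> * - sin t)) * (u t * sin t) + 4 * (e * (a + \<rho> * cos t)) * (v t * sin t + u t * cos t))) (at t)"
      unfolding F_def[abs_def] by (auto intro!: derivative_eq_intros)
    moreover have "q t * (- 4 * v t * sin t + 2 * u t * cos t)
        + (4 * (e * (\<rho> * - sin t)) * (u t * sin t) + 4 * (e * (a + \<rho> * cos t)) * (v t * sin t + u t * cos t))
      = e * (u t * (\<rho> + 5 * \<rho> * cos (2 * t) + 6 * a * cos t))"
    proof -
      have "q t * (- 4 * v t * sin t + 2 * u t * cos t)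
          + (4 * (e * (\<rho> * - sin t)) * (u t * sin t) + 4 * (e * (a + \<rho> * cos t)) * (v t * sin t + u t * cos t))
        = e * (u t * (6 * (a + \<rho> * cos t) * cos t - 4 * \<rho> * (sin t)\<^sup>2))"
        unfolding q by (simp add: algebra_simps power2_eq_square)
      also have "\<dots> = e * (u t * (\<rho> + 5 * \<rho> * cos (2 * t) + 6 * a * cos t))"
        unfolding sin_squared_eq cos_double_cos by (simp add: algebra_simps power2_eq_square)
      finally show ?thesis .
    qed
    ultimately show ?thesis by (simp only:)
  qed
  then have "((\<lambda>t. e * (u t * (\<rho> + 5 * \<rho> * cos (2 * t) + 6 * a * cos t))) has_integral F (2 * pi) - F 0) {0..2*pi}"
    by (intro fundamental_theorem_of_calculus)
      (auto simp: has_real_derivative_iff_has_vector_derivative has_vector_derivative_at_within)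
  moreover have "F (2 * pi) = 2 * u (2 * pi) * v (2 * pi)" "F 0 = 2 * u 0 * v 0"
    by (simp_all add: F_def Y_def)
  ultimately show ?thesis by simp
qed

section \<open>Net gain over one period\<close>

lemma continuous_on_u: "continuous_on S u"
  by (rule DERIV_continuous_on, rule has_field_derivative_at_within, rule DERIV_u)

text \<open>The kernel is at most 6 (\<rho> + |a|) in modulus and the period below 7, hence the 42
  in \<open>e2\<close>: replacing u by the orbit costs at most half of the averaged drift 2 (\<rho>
  - 3 |a|) sqrt (A 0). The other half is at least \<rho> - 3 |a| because A \<ge> 1.\<close>

lemma drift_per_period:
  assumes q: "\<And>t. q t = e * (a + \<rho> * cos t)"
    and \<rho>: "\<rho> > 3 * \<bar>a\<bar>"
    and e1: "14 * (\<bar>e\<bar> * (\<rho> + \<bar>a\<bar>)) \<le> 1"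
    and e2: "42 * (\<rho> + \<bar>a\<bar>) * sqrt (280 * (\<bar>e\<bar> * (\<rho> + \<bar>a\<bar>))) \<le> \<rho> - 3 * \<bar>a\<bar>"
  shows "e\<^sup>2 * (\<rho> - 3 * \<bar>a\<bar>) \<le> e * (2 * u (2 * pi) * v (2 * pi) - 2 * u 0 * v 0)"
proof -
  let ?P = "\<rho> + \<bar>a\<bar>" and ?k = "\<lambda>t. \<rho> + 5 * \<rho> * cos (2 * t) + 6 * a * cos t"
  let ?\<eta> = "\<bar>e\<bar> * ?P" and ?d = "\<rho> - 3 * \<bar>a\<bar>"
  have \<rho>0: "\<rho> > 0" using \<rho> by linarith
  have \<rho>c: "\<bar>\<rho> * cos t\<bar> \<le> \<rho>" and ac: "\<bar>a * cos t\<bar> \<le> \<bar>a\<bar>" for t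
    using abs_cos_le_one[of t] \<rho>0 by (simp_all add: abs_mult mult_left_le)
  have "\<bar>a + \<rho> * cos t\<bar> \<le> ?P" for t using \<rho>c[of t] by linarith
  then have q_le: "\<bar>q t\<bar> \<le> ?\<eta>" for t unfolding q abs_mult by (intro mult_left_mono) auto
  have "\<bar>\<rho> + 5 * x + 6 * y\<bar> \<le> 6 * ?P" if "\<bar>x\<bar> \<le> \<rho>" "\<bar>y\<bar> \<le> \<bar>a\<bar>" for x y
  proof -
    have "x \<le> \<rho>" "- x \<le> \<rho>" "y \<le> \<bar>a\<bar>" "- y \<le> \<bar>a\<bar>" using that by simp_all
    then show ?thesis unfolding distrib_left by (intro abs_leI) linarith+
  qed
  from this[OF \<rho>c ac] have k_le: "\<bar>?k t\<bar> \<le> 6 * ?P" for t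
    by (simp only: mult.assoc)
  have cont: "continuous_on {0..2*pi} ?k" by (intro continuous_intros)
  define Iu where "Iu = integral {0..2*pi} (\<lambda>t. u t * ?k t)"
  define T where "T = integral {0..2*pi} (\<lambda>t. orbit.U t * ?k t)"
  have Iu: "((\<lambda>t. u t * ?k t) has_integral Iu) {0..2*pi}" unfolding Iu_def
    by (intro integrable_integral integrable_continuous_interval continuous_on_mult continuous_on_u cont)
  have T: "((\<lambda>t. orbit.U t * ?k t) has_integral T) {0..2*pi}" unfolding T_def
    by (intro integrable_integral integrable_continuous_interval continuous_on_mult orbit.continuous_on_U cont)
  have "((\<lambda>t. orbit.U t * ?k t - sqrt (280 * ?\<eta>) * sqrt (A 0) * (6 * ?P)) has_integral
      T - 2 * pi * (sqrt (280 * ?\<eta>) * sqrt (A 0) * (6 * ?P))) {0..2*pi}"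
    by (intro has_integral_diff T has_integral_const_2pi)
  then have "T - 2 * pi * (sqrt (280 * ?\<eta>) * sqrt (A 0) * (6 * ?P)) \<le> Iu"
  proof (rule has_integral_le[OF _ Iu])
    fix t assume t: "t \<in> {0..2*pi}"
    have "\<bar>(u t - orbit.U t) * ?k t\<bar> \<le> sqrt (280 * ?\<eta>) * sqrt (A 0) * (6 * ?P)"
      unfolding abs_mult using abs_u_minus_orbit_le[OF q_le e1 t] k_le by (intro mult_mono) auto
    then show "orbit.U t * ?k t - sqrt (280 * ?\<eta>) * sqrt (A 0) * (6 * ?P) \<le> u t * ?k t"
      unfolding left_diff_distrib by linarith
  qed
  moreover have "2 * pi * (sqrt (280 * ?\<eta>) * sqrt (A 0) * (6 * ?P)) \<le> 7 * (sqrt (280 * ?\<eta>) * sqrt (A 0) * (6 * ?P))"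
    using pi_approx \<rho>0 A_ge_1[of 0] by (intro mult_right_mono mult_nonneg_nonneg) auto
  moreover have "7 * (sqrt (280 * ?\<eta>) * sqrt (A 0) * (6 * ?P)) \<le> ?d * sqrt (A 0)"
  proof -
    have eq: "7 * (s * w * (6 * c)) = 42 * c * s * w" for s w c :: real by simp
    show ?thesis unfolding eq by (rule mult_right_mono[OF e2]) (use A_ge_1[of 0] in simp)
  qed
  moreover have "2 * ?d * sqrt (A 0) \<le> T"
    by (rule orbit.averaged_drift_ge[OF T \<rho>])
  moreover have "?d \<le> ?d * sqrt (A 0)" using A_ge_1[of 0] \<rho> by (simp add: mult_le_cancel_left1)
  ultimately have "?d \<le> Iu" by linarith
  \<comment> \<open>One factor e comes from the forcing, the other makes the gain positive for
    either sign of e.\<close>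
  then have "e\<^sup>2 * ?d \<le> e\<^sup>2 * Iu" by (intro mult_left_mono) auto
  moreover have "e * Iu = 2 * u (2 * pi) * v (2 * pi) - 2 * u 0 * v 0"
    by (rule has_integral_unique[OF has_integral_mult_right[OF Iu] drift_has_integral[OF q]])
  ultimately show ?thesis by (metis mult.assoc power2_eq_square)
qed

end

text \<open>The polar form of (a1, b1) gives the forcing e (a0 + \<rho> cos (t - \<theta>)) with
  \<rho> > 3 |a0|. In each period e u v, taken at phase \<theta>, gains a fixed positive amount,
  which is impossible while u and v stay bounded.\<close>

lemma pinney_unbounded:
  fixes a0 a1 b1 :: real
  assumes ineq: "a1\<^sup>2 + b1\<^sup>2 > 9 * a0\<^sup>2"
  obtains \<epsilon>0 where "\<epsilon>0 > 0"
    and "\<And>e u v M. 0 < \<bar>e\<bar> \<Longrightarrow> \<bar>e\<bar> < \<epsilon>0 \<Longrightarrow>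
      pinney_solution u v (\<lambda>t. e * (a0 + a1 * cos t + b1 * sin t)) \<Longrightarrow> \<exists>t. M < \<bar>u t\<bar> + \<bar>v t\<bar>"
proof -
  define \<rho> where "\<rho> = sqrt (a1\<^sup>2 + b1\<^sup>2)"
  have "sqrt ((3 * a0)\<^sup>2) < \<rho>"
    unfolding \<rho>_def using ineq by (intro real_sqrt_less_mono) (simp add: power_mult_distrib)
  then have \<rho>: "\<rho> > 3 * \<bar>a0\<bar>" unfolding real_sqrt_abs by (simp add: abs_mult)
  then have \<rho>0: "\<rho> > 0" by linarith
  have "a1\<^sup>2 + b1\<^sup>2 = \<rho>\<^sup>2" by (simp add: \<rho>_def)
  then have "(a1 / \<rho>)\<^sup>2 + (b1 / \<rho>)\<^sup>2 = 1"
    unfolding power_divide add_divide_distrib[symmetric] using \<rho>0 by simp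
  then obtain \<theta> where "a1 / \<rho> = cos \<theta>" "b1 / \<rho> = sin \<theta>"
    using sincos_total_2pi by metis
  then have \<theta>: "a1 = \<rho> * cos \<theta>" "b1 = \<rho> * sin \<theta>" using \<rho>0 by (simp_all add: field_simps)
  let ?P = "\<rho> + \<bar>a0\<bar>" and ?d = "\<rho> - 3 * \<bar>a0\<bar>"
  have P: "?P > 0" and d: "?d > 0" using \<rho> \<rho>0 by linarith+
  \<comment> \<open>The two entries solve the smallness conditions \<open>e1\<close> and
    \<open>e2\<close> of \<open>drift_per_period\<close> for |e|; neither depends on the
    solution.\<close>
  define \<epsilon>0 where "\<epsilon>0 = min (1 / (14 * ?P)) ((?d / (42 * ?P))\<^sup>2 / (280 * ?P))"
  show thesis
  proof (rule that[of \<epsilon>0])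
    show "\<epsilon>0 > 0" unfolding \<epsilon>0_def using P d by simp
  next
    fix e M :: real and u v :: "real \<Rightarrow> real"
    assume e0: "0 < \<bar>e\<bar>" and e1: "\<bar>e\<bar> < \<epsilon>0"
      and "pinney_solution u v (\<lambda>t. e * (a0 + a1 * cos t + b1 * sin t))"
    then interpret pinney_solution u v "\<lambda>t. e * (a0 + a1 * cos t + b1 * sin t)" by simp
    have "\<bar>e\<bar> < 1 / (14 * ?P)" using e1 by (simp add: \<epsilon>0_def)
    then have E1: "14 * (\<bar>e\<bar> * ?P) \<le> 1" using P by (simp add: pos_less_divide_eq mult_ac)
    have "\<bar>e\<bar> < (?d / (42 * ?P))\<^sup>2 / (280 * ?P)" using e1 by (simp add: \<epsilon>0_def)
    then have "\<bar>e\<bar> * (280 * ?P) < (?d / (42 * ?P))\<^sup>2" using P by (simp only: pos_less_divide_eq mult_pos_pos zero_less_numeral)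
    then have "sqrt (280 * (\<bar>e\<bar> * ?P)) \<le> ?d / (42 * ?P)"
      using P d by (intro real_le_lsqrt) (auto simp: mult_ac)
    then have E2: "42 * ?P * sqrt (280 * (\<bar>e\<bar> * ?P)) \<le> ?d"
      using P by (simp add: pos_le_divide_eq mult_ac)
    define h where "h n = e * (2 * u (\<theta> + of_nat n * (2 * pi)) * v (\<theta> + of_nat n * (2 * pi)))" for n :: nat
    have step: "h n + e\<^sup>2 * ?d \<le> h (Suc n)" for n
    proof -
      define c where "c = \<theta> + of_nat n * (2 * pi)"
      have q: "e * (a0 + a1 * cos (t + c) + b1 * sin (t + c)) = e * (a0 + \<rho> * cos t)" for t
      proof -
        have "cos (t + c) = cos (t + \<theta>)" "sin (t + c) = sin (t + \<theta>)"
          unfolding c_def add.assoc[symmetric] using cos.plus_of_nat[of "t + \<theta>" n] sin.plus_of_nat[of "t + \<theta>" n] by simp_all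
        then have "a1 * cos (t + c) + b1 * sin (t + c) = \<rho> * cos ((t + \<theta>) - \<theta>)"
          unfolding cos_diff \<theta> by (simp add: algebra_simps)
        then show ?thesis by simp
      qed
      have "pinney_solution (\<lambda>t. u (t + c)) (\<lambda>t. v (t + c)) (\<lambda>t. e * (a0 + \<rho> * cos t))"
      proof
        fix t
        show "((\<lambda>t. u (t + c)) has_real_derivative v (t + c)) (at t)"
          using DERIV_u[of "t + c"] by (simp only: DERIV_shift)
        show "((\<lambda>t. v (t + c)) has_real_derivative (1 / (u (t + c)) ^ 3 - u (t + c)) / 4 + e * (a0 + \<rho> * cos t)) (at t)"
          using DERIV_v[of "t + c"] by (simp only: DERIV_shift q)
        show "u (t + c) > 0" by (rule u_pos)
      qed
      from pinney_solution.drift_per_period[OF this refl \<rho> E1 E2]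
      show ?thesis by (simp add: h_def c_def algebra_simps)
    qed
    have h_ge: "h 0 + of_nat n * (e\<^sup>2 * ?d) \<le> h n" for n
    proof (induction n)
      case (Suc n)
      then show ?case using step[of n] by (simp add: algebra_simps)
    qed simp
    show "\<exists>t. M < \<bar>u t\<bar> + \<bar>v t\<bar>"
    proof (rule ccontr)
      assume "\<nexists>t. M < \<bar>u t\<bar> + \<bar>v t\<bar>"
      then have le: "\<bar>u t\<bar> + \<bar>v t\<bar> \<le> M" for t by (meson not_le)
      have M: "\<bar>u t\<bar> \<le> M" "\<bar>v t\<bar> \<le> M" for t using le[of t] by linarith+
      have "\<bar>u t * v t\<bar> \<le> M * M" for t
        unfolding abs_mult using M[of t] by (intro mult_mono) auto
      then have "\<bar>e\<bar> * (2 * \<bar>u t * v t\<bar>) \<le> \<bar>e\<bar> * (2 * (M * M))" for t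
        by (intro mult_left_mono) auto
      then have h_le: "\<bar>h n\<bar> \<le> \<bar>e\<bar> * (2 * (M * M))" for n
        unfolding h_def by (simp add: abs_mult)
      have "e\<^sup>2 * ?d > 0" using e0 d by simp
      \<comment> \<open>All values of h lie in an interval of length twice the bound from
        \<open>h_le\<close>; n periods must gain more than that.\<close>
      then obtain n :: nat where "2 * (\<bar>e\<bar> * (2 * (M * M))) < of_nat n * (e\<^sup>2 * ?d)"
        using reals_Archimedean3 by blast
      then show False using h_ge[of n] h_le[of n] h_le[of 0] by linarith
    qed
  qed
qed

section \<open>Continuation of bounded solutions\<close>

text \<open>L'Hospital's rule for the difference quotient. It serves at the gluing point of two
  solutions, where derivatives are first known only on either side.\<close>

lemma DERIV_of_tendsto_derivative:
  fixes y y' :: "real \<Rightarrow> real"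
  assumes y: "isCont y b" and y': "isCont y' b"
    and D: "eventually (\<lambda>t. (y has_real_derivative y' t) (at t)) (at b)"
  shows "(y has_real_derivative y' b) (at b)"
proof -
  have "((\<lambda>t. (y t - y b) / (t - b)) \<longlongrightarrow> y' b) (at b)"
  proof (rule lhopital[where f' = y' and g' = "\<lambda>_. 1"])
    show "((\<lambda>t. y t - y b) \<longlongrightarrow> 0) (at b)" using y by (simp add: isCont_def LIM_zero_iff)
    show "((\<lambda>t. t - b) \<longlongrightarrow> 0) (at b)" by (simp add: LIM_zero_iff)
    show "\<forall>\<^sub>F t in at b. t - b \<noteq> 0" by (simp add: eventually_at_filter)
    show "\<forall>\<^sub>F t in at b. ((\<lambda>t. y t - y b) has_real_derivative y' t) (at t)"
      using D by eventually_elim (auto intro!: derivative_eq_intros)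
    show "\<forall>\<^sub>F t in at b. ((\<lambda>t. t - b) has_real_derivative 1) (at t)"
      by (intro always_eventually allI) (auto intro!: derivative_eq_intros)
    show "((\<lambda>t. y' t / 1) \<longlongrightarrow> y' b) (at b)" using y' by (simp add: isCont_def)
  qed simp
  then show ?thesis by (simp add: has_field_derivative_iff)
qed

text \<open>Picard iteration for the integral form of z'' = F t z. The contraction acts on the
  position alone, the velocity being recovered by integration.\<close>

lemma second_order_local_existence:
  fixes F :: "real \<Rightarrow> real \<Rightarrow> real" and b zi wi :: real
  assumes cont: "continuous_on UNIV (\<lambda>(t, z). F t z)"
    and lip: "\<And>t x y. \<bar>F t x - F t y\<bar> \<le> K * \<bar>x - y\<bar>"
  obtains h z w where "h > 0" "z b = zi" "w b = wi"
    "\<And>t. t \<in> {b..b+h} \<Longrightarrow> (z has_real_derivative w t) (at t within {b..b+h})"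
    "\<And>t. t \<in> {b..b+h} \<Longrightarrow> (w has_real_derivative F t (z t)) (at t within {b..b+h})"
proof -
  have K: "K \<ge> 0" using lip[of 0 0 1] abs_ge_zero[of "F 0 0 - F 0 1"] by simp
  \<comment> \<open>K h \<le> 1/2 gives the contraction factor in \<open>W_diff\<close>, and h \<le>
    1 preserves it in \<open>Z_diff\<close>; K + 1 avoids division by zero.\<close>
  define h where "h = 1 / (2 * (K + 1))"
  have h: "h > 0" "h \<le> 1" "K * h \<le> 1 / 2" using K by (auto simp: h_def field_simps)
  define I where "I = {b..b+h}"
  define W where "W z s = wi + integral {b..s} (\<lambda>\<tau>. F \<tau> (z \<tau>))" for z s
  define Z where "Z z s = zi + integral {b..s} (W z)" for z s
  have cF: "continuous_on S (\<lambda>\<tau>. F \<tau> (z \<tau>))" if "continuous_on S z" for S z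
    using continuous_on_compose2[OF cont, of S "\<lambda>\<tau>. (\<tau>, z \<tau>)"] that
    by (simp add: continuous_on_Pair)
  have DW: "(W z has_real_derivative F t (z t)) (at t within I)"
    if "continuous_on I z" "t \<in> I" for z t
    unfolding W_def[abs_def] using integral_has_real_derivative[OF cF[OF that(1)[unfolded I_def]], of t] that(2)
    by (auto simp: I_def intro!: derivative_eq_intros)
  have cW: "continuous_on I (W z)" if "continuous_on I z" for z
    using DW[OF that] by (rule DERIV_continuous_on)
  have DZ: "(Z z has_real_derivative W z t) (at t within I)"
    if "continuous_on I z" "t \<in> I" for z t
    unfolding Z_def[abs_def] using integral_has_real_derivative[OF cW[OF that(1), unfolded I_def], of t] that(2)
    by (auto simp: I_def intro!: derivative_eq_intros)
  have cZ: "continuous_on I (Z z)" if "continuous_on I z" for z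
    using DZ[OF that] by (rule DERIV_continuous_on)
  have sub: "{b..s} \<subseteq> I" if "s \<in> I" for s using that by (auto simp: I_def)
  have W_diff: "\<bar>W x s - W y s\<bar> \<le> 1 / 2 * d"
    if "continuous_on I x" "continuous_on I y" and d: "\<And>t. \<bar>x t - y t\<bar> \<le> d" and s: "s \<in> I" for x y d s
  proof -
    have d0: "d \<ge> 0" using d[of 0] by linarith
    have c: "continuous_on {b..s} x" "continuous_on {b..s} y"
      using that(1,2) sub[OF s] continuous_on_subset by blast+
    have "W x s - W y s = integral {b..s} (\<lambda>\<tau>. F \<tau> (x \<tau>) - F \<tau> (y \<tau>))"
      unfolding W_def by (simp add: integral_diff integrable_continuous_interval cF c)
    also have "norm \<dots> \<le> K * d * (s - b)"
    proof (rule integral_bound)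
      show "b \<le> s" using s by (simp add: I_def)
      show "continuous_on {b..s} (\<lambda>\<tau>. F \<tau> (x \<tau>) - F \<tau> (y \<tau>))"
        by (intro continuous_on_diff cF c)
      show "norm (F \<tau> (x \<tau>) - F \<tau> (y \<tau>)) \<le> K * d" for \<tau>
        using order_trans[OF lip mult_left_mono[OF d K]] by simp
    qed
    also have "\<dots> \<le> K * d * h" using s K d0 by (intro mult_left_mono) (auto simp: I_def)
    also have "\<dots> \<le> 1 / 2 * d" using mult_right_mono[OF h(3) d0] by (simp add: mult_ac)
    finally show ?thesis by simp
  qed
  have Z_diff: "\<bar>Z x s - Z y s\<bar> \<le> 1 / 2 * d"
    if "continuous_on I x" "continuous_on I y" and d: "\<And>t. \<bar>x t - y t\<bar> \<le> d" and s: "s \<in> I" for x y d s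
  proof -
    have d0: "d \<ge> 0" using d[of 0] by linarith
    note cx = that(1) and cy = that(2)
    have c: "continuous_on {b..s} (W x)" "continuous_on {b..s} (W y)"
      using cW[OF that(1)] cW[OF that(2)] sub[OF s] continuous_on_subset by blast+
    have "Z x s - Z y s = integral {b..s} (\<lambda>\<tau>. W x \<tau> - W y \<tau>)"
      unfolding Z_def by (simp add: integral_diff integrable_continuous_interval c)
    also have "norm \<dots> \<le> 1 / 2 * d * (s - b)"
    proof (rule integral_bound)
      show "b \<le> s" using s by (simp add: I_def)
      show "continuous_on {b..s} (\<lambda>\<tau>. W x \<tau> - W y \<tau>)"
        by (intro continuous_on_diff c)
      show "norm (W x \<tau> - W y \<tau>) \<le> 1 / 2 * d" if "\<tau> \<in> {b..s}" for \<tau>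
        using W_diff[OF cx cy d] sub[OF s] that by auto
    qed
    also have "\<dots> \<le> 1 / 2 * d * 1" using s h(2) d0 by (intro mult_left_mono) (auto simp: I_def)
    finally show ?thesis by simp
  qed
  \<comment> \<open>Retracting the line onto \<open>I\<close> lets the iteration act on bounded
    continuous functions on the whole line, a complete space.\<close>
  define clip where "clip t = max b (min t (b + h))" for t
  have clip: "clip t \<in> I" for t using h by (auto simp: clip_def I_def)
  have clip_id: "clip t = t" if "t \<in> I" for t using that by (auto simp: clip_def I_def)
  have bc: "(\<lambda>t. Z z (clip t)) \<in> bcontfun" if "continuous_on I z" for z
  proof -
    have "continuous_on UNIV (\<lambda>t. Z z (clip t))"
      by (rule continuous_on_compose2[OF cZ[OF that], of _ clip])
        (use clip in \<open>auto simp: clip_def intro!: continuous_intros\<close>)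
    moreover have "compact (Z z ` I)" by (rule compact_continuous_image[OF cZ[OF that]]) (simp add: I_def)
    then have "bounded (range (\<lambda>t. Z z (clip t)))"
      by (rule bounded_subset[OF compact_imp_bounded]) (use clip in auto)
    ultimately show ?thesis by (simp add: bcontfun_def)
  qed
  define T where "T z = Bcontfun (\<lambda>t. Z (apply_bcontfun z) (clip t))" for z :: "real \<Rightarrow>\<^sub>C real"
  have T: "apply_bcontfun (T z) t = Z (apply_bcontfun z) (clip t)" for z t
    unfolding T_def by (subst Bcontfun_inverse) (auto intro!: bc)
  have "dist (T x) (T y) \<le> 1 / 2 * dist x y" for x y
  proof (rule dist_bound)
    fix t
    show "dist (T x t) (T y t) \<le> 1 / 2 * dist x y"
      unfolding T dist_real_def
      by (rule Z_diff) (use clip dist_bounded[of x _ y] in \<open>auto simp: dist_real_def\<close>)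
  qed
  then obtain z where z: "T z = z" using banach_fix_type[of "1/2" T] by auto
  have zZ: "apply_bcontfun z t = Z z t" if "t \<in> I" for t
    using T[of z t] unfolding z clip_id[OF that] .
  have cz: "continuous_on I (apply_bcontfun z)" by simp
  show thesis
  proof (rule that[of h "Z z" "W z"])
    fix t assume "t \<in> {b..b+h}"
    then have t: "t \<in> I" by (simp add: I_def)
    show "(Z z has_real_derivative W z t) (at t within {b..b+h})"
      using DZ[OF cz t] by (simp add: I_def)
    show "(W z has_real_derivative F t (Z z t)) (at t within {b..b+h})"
      using DW[OF cz t] by (simp add: I_def zZ[OF t])
  qed (use h in \<open>simp_all add: Z_def W_def\<close>)
qed

section \<open>Gluing a solution beyond its endpoint\<close>

lemma solution_onD:
  assumes "solution_on g q D I x" "t \<in> I"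
  shows "x t \<in> D" "(x has_real_derivative deriv x t) (at t)"
    "(deriv x has_real_derivative q t - g (x t)) (at t)"
proof -
  have *: "x t \<in> D" "x differentiable (at t)" "deriv x differentiable (at t)"
    "deriv (deriv x) t + g (x t) = q t"
    using assms unfolding solution_on_def by auto
  show "x t \<in> D" by fact
  show "(x has_real_derivative deriv x t) (at t)"
    using *(2) by (simp add: DERIV_deriv_iff_real_differentiable)
  have "(deriv x has_real_derivative deriv (deriv x) t) (at t)"
    using *(3) by (simp add: DERIV_deriv_iff_real_differentiable)
  moreover have "deriv (deriv x) t = q t - g (x t)" using *(4) by linarith
  ultimately show "(deriv x has_real_derivative q t - g (x t)) (at t)" by simp
qed

lemma solution_onI:
  assumes "open I" "is_interval I" "I \<noteq> {}"
    and D: "\<And>t. t \<in> I \<Longrightarrow> x t \<in> D"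
    and x: "\<And>t. t \<in> I \<Longrightarrow> (x has_real_derivative v t) (at t)"
    and v: "\<And>t. t \<in> I \<Longrightarrow> (v has_real_derivative q t - g (x t)) (at t)"
  shows "solution_on g q D I x"
  unfolding solution_on_def
proof (intro conjI ballI assms)
  fix t assume t: "t \<in> I"
  have "deriv x s = v s" if "s \<in> I" for s using x[OF that] by (rule DERIV_imp_deriv)
  then have d: "(deriv x has_real_derivative q t - g (x t)) (at t)"
    by (intro has_field_derivative_transform_within_open[OF v[OF t] assms(1) t]) simp
  show "x differentiable at t" using x[OF t] by (auto simp: real_differentiable_def)
  show "deriv x differentiable at t" using d by (auto simp: real_differentiable_def)
  show "deriv (deriv x) t + g (x t) = q t" using DERIV_imp_deriv[OF d] by simp
qed

text \<open>A bounded derivative makes f Lipschitz, hence uniformly continuous, and such a function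
  extends to the closure.\<close>

lemma bounded_derivative_imp_left_limit:
  fixes f f' :: "real \<Rightarrow> real"
  assumes cb: "c < b"
    and D: "\<And>t. c \<le> t \<Longrightarrow> t < b \<Longrightarrow> (f has_real_derivative f' t) (at t)"
    and le: "\<And>t. c \<le> t \<Longrightarrow> t < b \<Longrightarrow> \<bar>f' t\<bar> \<le> C"
  obtains l where "(f \<longlongrightarrow> l) (at_left b)"
proof -
  have C: "C \<ge> 0" using le[of c] cb by linarith
  have lip: "\<bar>f x - f y\<bar> \<le> C * \<bar>x - y\<bar>" if "x \<in> {c..<b}" "y \<in> {c..<b}" for x y
    using field_differentiable_bound[of "{c..<b}" f f' C x y] that D le
    by (auto intro: has_field_derivative_at_within)
  have "uniformly_continuous_on {c..<b} f"
    unfolding uniformly_continuous_on_def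
  proof (intro allI impI)
    fix e :: real assume "e > 0"
    show "\<exists>d>0. \<forall>x\<in>{c..<b}. \<forall>x'\<in>{c..<b}. dist x' x < d \<longrightarrow> dist (f x') (f x) < e"
    proof (intro exI[of _ "e / (C + 1)"] conjI ballI impI)
      show "e / (C + 1) > 0" using C \<open>e > 0\<close> by simp
      fix x x' assume "x \<in> {c..<b}" "x' \<in> {c..<b}" and d: "dist x' x < e / (C + 1)"
      then have "\<bar>f x' - f x\<bar> \<le> C * \<bar>x' - x\<bar>" by (intro lip)
      also have "\<dots> \<le> (C + 1) * \<bar>x' - x\<bar>" by (intro mult_right_mono) auto
      also have "\<dots> < e" using d C by (simp add: dist_real_def pos_less_divide_eq mult.commute)
      finally show "dist (f x') (f x) < e" by (simp add: dist_real_def)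
    qed
  qed
  moreover have "b \<in> closure {c..<b}" using cb by (simp add: closure_atLeastLessThan)
  ultimately obtain l where "(f \<longlongrightarrow> l) (at b within {c..<b})"
    by (rule uniformly_continuous_on_extension_at_closure)
  moreover have "at b within {c..<b} = at_left b"
  proof (rule at_within_nhd[of _ "{c<..}"])
    show "{c..<b} \<inter> {c<..} - {b} = {..<b} \<inter> {c<..} - {b}" by auto
  qed (use cb in auto)
  ultimately show thesis using that by simp
qed

text \<open>The solution \<open>(z, w)\<close> starting at \<open>b\<close> is glued to the limits of \<open>x\<close> and \<open>deriv x\<close>
  at \<open>b\<close>; no uniqueness is needed.\<close>

lemma solution_extends_right:
  fixes g G q x :: "real \<Rightarrow> real"
  assumes sol: "solution_on g q D I x"
    and q: "continuous_on UNIV q"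
    and lip: "\<And>y z. \<bar>G y - G z\<bar> \<le> K * \<bar>y - z\<bar>"
    and N: "open N" "N \<subseteq> D" "\<And>z. z \<in> N \<Longrightarrow> G z = g z"
    and C: "compact C" "C \<subseteq> N" "\<And>t. c \<le> t \<Longrightarrow> t < b \<Longrightarrow> x t \<in> C"
    and M: "\<And>t. c \<le> t \<Longrightarrow> t < b \<Longrightarrow> \<bar>deriv x t\<bar> \<le> M"
    and I: "c < b" "b \<notin> I" "{c..<b} \<subseteq> I" "I \<subseteq> {..<b}"
  obtains J y where "solution_on g q D J y" "I \<subseteq> J" "\<And>t. t \<in> I \<Longrightarrow> y t = x t" "J \<noteq> I"
proof -
  have openI: "open I" and ivI: "is_interval I" using sol by (auto simp: solution_on_def)
  note D = solution_onD[OF sol]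
  have K: "K \<ge> 0" using lip[of 0 1] abs_ge_zero[of "G 0 - G 1"] by simp
  have G: "continuous_on UNIV G"
    unfolding continuous_on_iff
  proof (intro ballI allI impI)
    fix y e :: real assume "e > 0"
    show "\<exists>d>0. \<forall>z\<in>UNIV. dist z y < d \<longrightarrow> dist (G z) (G y) < e"
    proof (intro exI[of _ "e / (K + 1)"] conjI ballI impI)
      show "e / (K + 1) > 0" using K \<open>e > 0\<close> by simp
      fix z assume d: "dist z y < e / (K + 1)"
      have "\<bar>G z - G y\<bar> \<le> (K + 1) * \<bar>z - y\<bar>"
        using order_trans[OF lip mult_right_mono[of K "K + 1"]] by simp
      also have "\<dots> < e" using d K by (simp add: dist_real_def pos_less_divide_eq mult.commute)
      finally show "dist (G z) (G y) < e" by (simp add: dist_real_def)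
    qed
  qed
  obtain z0 where z0: "(x \<longlongrightarrow> z0) (at_left b)"
    by (rule bounded_derivative_imp_left_limit[OF I(1), of x "deriv x" M])
      (use D(2) I(3) M in auto)
  have left: "\<forall>\<^sub>F t in at_left b. t \<in> {c..<b}"
    unfolding eventually_at_left_field using I(1) by (intro exI[of _ c]) auto
  have "z0 \<in> C"
    by (rule Lim_in_closed_set[OF compact_imp_closed[OF C(1)] _ _ z0])
      (use left C(3) in \<open>auto elim: eventually_mono\<close>)
  then have z0N: "z0 \<in> N" using C(2) by blast
  have "bounded ((\<lambda>t. q t) ` {c..b})"
    by (intro compact_imp_bounded compact_continuous_image continuous_on_subset[OF q]) auto
  then obtain Q where "\<forall>t\<in>{c..b}. \<bar>q t\<bar> \<le> Q" by (auto simp: bounded_iff)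
  then have Q: "\<bar>q t\<bar> \<le> Q" if "t \<in> {c..b}" for t using that by blast
  have "bounded (G ` C)"
    by (intro compact_imp_bounded compact_continuous_image continuous_on_subset[OF G] C) auto
  then obtain R where "\<forall>z\<in>C. \<bar>G z\<bar> \<le> R" by (auto simp: bounded_iff)
  then have R: "\<bar>G z\<bar> \<le> R" if "z \<in> C" for z using that by blast
  obtain w0 where w0: "(deriv x \<longlongrightarrow> w0) (at_left b)"
  proof (rule bounded_derivative_imp_left_limit[OF I(1), of "deriv x" "\<lambda>t. q t - g (x t)" "Q + R"])
    fix t assume t: "c \<le> t" "t < b"
    then show "(deriv x has_real_derivative q t - g (x t)) (at t)" using D(3) I(3) by auto
    have "g (x t) = G (x t)" using C(2) C(3)[OF t] N(3) by auto
    then show "\<bar>q t - g (x t)\<bar> \<le> Q + R" using Q[of t] R[OF C(3)[OF t]] t by simp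
  qed
  \<comment> \<open>The initial value problem is solved with the globally Lipschitz
    \<open>G\<close>; membership in \<open>N\<close> later turns \<open>G\<close> back into
    \<open>g\<close>.\<close>
  have cont: "continuous_on UNIV (\<lambda>(t, z). q t - G z)"
    unfolding case_prod_beta
    by (intro continuous_on_diff continuous_on_compose2[OF q] continuous_on_compose2[OF G] continuous_intros) auto
  have lip': "\<bar>(q t - G y) - (q t - G z)\<bar> \<le> K * \<bar>y - z\<bar>" for t y z
    using lip[of y z] by linarith
  obtain h0 z w where h0: "h0 > 0" and zb: "z b = z0" "w b = w0"
    and Dz: "\<And>t. t \<in> {b..b+h0} \<Longrightarrow> (z has_real_derivative w t) (at t within {b..b+h0})"
    and Dw: "\<And>t. t \<in> {b..b+h0} \<Longrightarrow> (w has_real_derivative q t - G (z t)) (at t within {b..b+h0})"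
    by (rule second_order_local_existence[OF cont lip', where zi = z0 and wi = w0 and b = b]) (rule that)
  have right: "at_right b = at b within {b..b+h0}"
    using at_within_Icc_at_right[of b "b + h0"] h0 by simp
  have zr: "(z \<longlongrightarrow> z0) (at_right b)" and wr: "(w \<longlongrightarrow> w0) (at_right b)"
    unfolding right using DERIV_continuous[OF Dz[of b]] DERIV_continuous[OF Dw[of b]] h0
    by (simp_all add: continuous_within zb)
  have "\<forall>\<^sub>F t in at_right b. z t \<in> N"
    using topological_tendstoD[OF zr N(1) z0N] .
  then obtain h1 where h1: "h1 > b" "\<And>t. b < t \<Longrightarrow> t < h1 \<Longrightarrow> z t \<in> N"
    unfolding eventually_at_right_field by blast
  \<comment> \<open>Between b and r the new piece both exists and stays in \<open>N\<close>.\<close>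
  define r where "r = min h1 (b + h0)"
  have r: "b < r" "r \<le> h1" "r \<le> b + h0" using h1 h0 by (auto simp: r_def)
  have zN: "z t \<in> N" if "b \<le> t" "t < r" for t
    using that h1(2)[of t] r z0N zb by (cases "t = b") auto
  define y where "y t = (if t < b then x t else z t)" for t
  define v where "v t = (if t < b then deriv x t else w t)" for t
  define J where "J = I \<union> {c<..<r}"
  have J: "t \<in> I \<and> t < b \<or> b \<le> t \<and> t < r" if "t \<in> J" for t
    using that I by (auto simp: J_def)
  have yD: "y t \<in> D" if "t \<in> J" for t
    using J[OF that] D(1) zN N(2) by (auto simp: y_def)
  have gy: "g (y t) = G (y t)" if "b \<le> t" "t < r" for t
    using zN[OF that] N(3) that by (simp add: y_def)
  have Dl: "(y has_real_derivative v t) (at t)" "(v has_real_derivative q t - g (y t)) (at t)"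
    if "t \<in> I" "t < b" for t
  proof -
    show "(y has_real_derivative v t) (at t)"
      by (rule has_field_derivative_transform_within_open[of x _ _ "{..<b}"])
        (use that D(2) in \<open>auto simp: y_def v_def\<close>)
    show "(v has_real_derivative q t - g (y t)) (at t)"
      by (rule has_field_derivative_transform_within_open[of "deriv x" _ _ "{..<b}"])
        (use that D(3) in \<open>auto simp: y_def v_def\<close>)
  qed
  have Dr: "(y has_real_derivative v t) (at t)" "(v has_real_derivative q t - g (y t)) (at t)"
    if "b < t" "t < r" for t
  proof -
    have t: "t \<in> {b..b+h0}" "at t within {b..b+h0} = at t"
      using that r by (auto intro!: at_within_Icc_at)
    show "(y has_real_derivative v t) (at t)"
      by (rule has_field_derivative_transform_within_open[of z _ _ "{b<..}"])
        (use that Dz[OF t(1)] t(2) in \<open>auto simp: y_def v_def\<close>)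
    show "(v has_real_derivative q t - g (y t)) (at t)"
      unfolding gy[OF less_imp_le[OF that(1)] that(2)]
      by (rule has_field_derivative_transform_within_open[of w _ _ "{b<..}"])
        (use that Dw[OF t(1)] t(2) in \<open>auto simp: y_def v_def\<close>)
  qed
  have cy: "isCont y b" and cv: "isCont v b"
  proof -
    have lt: "\<forall>\<^sub>F t in at_left b. t < b" and gt: "\<forall>\<^sub>F t in at_right b. \<not> t < b"
      by (auto simp: eventually_at_filter)
    have "(y \<longlongrightarrow> z0) (at_left b)" "(v \<longlongrightarrow> w0) (at_left b)"
      using lt by (auto intro!: Lim_transform_eventually[OF z0] Lim_transform_eventually[OF w0]
          elim!: eventually_mono simp: y_def v_def)
    moreover have "(y \<longlongrightarrow> z0) (at_right b)" "(v \<longlongrightarrow> w0) (at_right b)"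
      using gt by (auto intro!: Lim_transform_eventually[OF zr] Lim_transform_eventually[OF wr]
          elim!: eventually_mono simp: y_def v_def)
    ultimately show "isCont y b" "isCont v b"
      by (simp_all add: isCont_def filterlim_at_split y_def v_def zb)
  qed
  have near: "\<forall>\<^sub>F t in at b. t \<noteq> b \<and> c < t \<and> t < r"
    unfolding eventually_at_topological
    by (intro exI[of _ "{c<..<r}"]) (use I(1) r(1) in auto)
  have side: "(y has_real_derivative v t) (at t)" "(v has_real_derivative q t - g (y t)) (at t)"
    if "t \<noteq> b \<and> c < t \<and> t < r" for t
  proof -
    have "t \<in> I \<and> t < b \<or> b < t \<and> t < r" using that I(3) by auto
    then show "(y has_real_derivative v t) (at t)" "(v has_real_derivative q t - g (y t)) (at t)"
      using Dl[of t] Dr[of t] by blast+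
  qed
  \<comment> \<open>At the seam the two-sided derivative comes from continuity of y and v together
    with the equations on both sides.\<close>
  have Db1: "(y has_real_derivative v b) (at b)"
    by (rule DERIV_of_tendsto_derivative[OF cy cv]) (rule eventually_mono[OF near side(1)])
  \<comment> \<open>\<open>G\<close> is continuous everywhere, so the second derivative can be
    passed to the limit at b once it is written with \<open>G\<close>.\<close>
  have gy': "g (y t) = G (y t)" if "c < t" "t < r" for t
  proof (cases "t < b")
    case True
    then have "y t \<in> N" using C(2) C(3)[of t] that by (auto simp: y_def)
    then show ?thesis using N(3) by simp
  qed (use gy that in auto)
  have "(v has_real_derivative q b - G (y b)) (at b)"
  proof (rule DERIV_of_tendsto_derivative[OF cv, of "\<lambda>t. q t - G (y t)"])
    have "isCont q b" "isCont G (y b)"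
      using q G by (simp_all add: continuous_on_eq_continuous_at)
    then show "isCont (\<lambda>t. q t - G (y t)) b"
      by (intro continuous_diff isCont_o2[OF cy]) auto
    show "\<forall>\<^sub>F t in at b. (v has_real_derivative q t - G (y t)) (at t)"
      by (rule eventually_mono[OF near]) (use side(2) gy' in metis)
  qed
  then have Db2: "(v has_real_derivative q b - g (y b)) (at b)"
    using gy r by simp
  have DJ: "(y has_real_derivative v t) (at t)" "(v has_real_derivative q t - g (y t)) (at t)"
    if "t \<in> J" for t
  proof -
    have "t \<in> I \<and> t < b \<or> b < t \<and> t < r \<or> t = b" using J[OF that] by auto
    then show "(y has_real_derivative v t) (at t)" "(v has_real_derivative q t - g (y t)) (at t)"
      using Dl[of t] Dr[of t] Db1 Db2 by blast+
  qed
  show thesis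
  proof (rule that[of J y])
    show "solution_on g q D J y"
    proof (rule solution_onI[of J _ D v])
      show "open J" unfolding J_def by (intro open_Un openI open_greaterThanLessThan)
      have "connected J"
        unfolding J_def
      proof (rule connected_Un)
        show "connected I" using ivI by (simp add: is_interval_connected_1)
        have "(c + b) / 2 \<in> I \<inter> {c<..<r}" using I r by auto
        then show "I \<inter> {c<..<r} \<noteq> {}" by blast
      qed simp
      then show "is_interval J" by (simp add: is_interval_connected_1)
      show "J \<noteq> {}" using I r by (auto simp: J_def)
    qed (use yD DJ in auto)
    show "I \<subseteq> J" by (simp add: J_def)
    show "y t = x t" if "t \<in> I" for t using that I(4) by (auto simp: y_def)
    have "b \<in> J" using I r by (simp add: J_def)
    then show "J \<noteq> I" using I(2) by blast
  qed
qed

text \<open>The second derivative is invariant under time reversal, so only the forcing is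
  reflected. This reduces left endpoints to right ones.\<close>

lemma solution_on_reflect:
  assumes sol: "solution_on g q D I x"
  shows "solution_on g (\<lambda>t. q (- t)) D (uminus ` I) (\<lambda>t. x (- t))"
proof (rule solution_onI[where v = "\<lambda>t. - deriv x (- t)"])
  have I: "open I" "is_interval I" "I \<noteq> {}" using sol by (auto simp: solution_on_def)
  show "open (uminus ` I)" using I(1) by (rule open_negations)
  show "is_interval (uminus ` I)" using I(2) by (simp only: is_interval_neg_translationI is_interval_uminus)
  show "uminus ` I \<noteq> {}" using I(3) by simp
  fix t assume "t \<in> uminus ` I"
  then have t: "- t \<in> I" by auto
  note D = solution_onD[OF sol t]
  have minus: "((\<lambda>s. - s) has_real_derivative - 1) (at t)" by (auto intro!: derivative_eq_intros)
  show "x (- t) \<in> D" by (rule D)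
  show "((\<lambda>t. x (- t)) has_real_derivative - deriv x (- t)) (at t)"
    using DERIV_chain2[OF D(2) minus] by simp
  show "((\<lambda>t. - deriv x (- t)) has_real_derivative q (- t) - g (x (- t))) (at t)"
    using DERIV_minus[OF DERIV_chain2[OF D(3) minus]] by simp
qed

section \<open>Bounded solutions of the singular equation are global\<close>

abbreviation (input) pinney_force :: "real \<Rightarrow> real" where
  "pinney_force \<equiv> \<lambda>x. 1 / 4 * (x + 1 - 1 / (x + 1) ^ 3)"

lemma pinney_solution_on_D:
  assumes "solution_on pinney_force q {-1<..} I x" "t \<in> I"
  shows "((\<lambda>t. x t + 1) has_real_derivative deriv x t) (at t)"
    "(deriv x has_real_derivative (1 / (x t + 1) ^ 3 - (x t + 1)) / 4 + q t) (at t)"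
    "x t + 1 > 0"
proof -
  note D = solution_onD[OF assms]
  show "((\<lambda>t. x t + 1) has_real_derivative deriv x t) (at t)"
    using DERIV_add[OF D(2) DERIV_const[of 1]] by simp
  have "q t - pinney_force (x t) = (1 / (x t + 1) ^ 3 - (x t + 1)) / 4 + q t"
  proof -
    have "q t - 1 / 4 * (r - w) = (w - r) / 4 + q t" for r w by (simp add: field_simps)
    then show ?thesis .
  qed
  from D(3)[unfolded this]
  show "(deriv x has_real_derivative (1 / (x t + 1) ^ 3 - (x t + 1)) / 4 + q t) (at t)" .
  show "x t + 1 > 0" using D(1) by simp
qed

text \<open>The derivative (1 + 3 / r^4) / 4 decreases in r, so its value at k bounds it on the
  half-line from k.\<close>

lemma pinney_force_lipschitz:
  fixes k r s :: real
  assumes "k > 0" "r \<ge> k" "s \<ge> k"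
  shows "\<bar>1 / 4 * (r - 1 / r ^ 3) - 1 / 4 * (s - 1 / s ^ 3)\<bar> \<le> 1 / 4 * (1 + 3 / k ^ 4) * \<bar>r - s\<bar>"
proof -
  have "norm (1 / 4 * (r - 1 / r ^ 3) - 1 / 4 * (s - 1 / s ^ 3)) \<le> 1 / 4 * (1 + 3 / k ^ 4) * norm (r - s)"
  proof (rule field_differentiable_bound[of "{k..}" "\<lambda>r. 1 / 4 * (r - 1 / r ^ 3)" "\<lambda>r. 1 / 4 * (1 + 3 / r ^ 4)"])
    fix z assume "z \<in> {k..}"
    then have z: "z > 0" "k \<le> z" using assms(1) by auto
    have "((\<lambda>r. 1 / 4 * (r - inverse (r ^ 3))) has_real_derivative
        1 / 4 * (1 - - (inverse (z ^ 3) * (3 * z\<^sup>2) * inverse (z ^ 3)))) (at z)"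
      using z by (auto intro!: derivative_eq_intros)
    moreover have "inverse (z ^ 3) * (3 * z\<^sup>2) * inverse (z ^ 3) = 3 / z ^ 4"
      using z by (simp add: field_simps power2_eq_square power3_eq_cube power4_eq_xxxx)
    ultimately show "((\<lambda>r. 1 / 4 * (r - 1 / r ^ 3)) has_field_derivative 1 / 4 * (1 + 3 / z ^ 4)) (at z within {k..})"
      by (simp add: inverse_eq_divide has_field_derivative_at_within)
    have "3 / z ^ 4 \<le> 3 / k ^ 4"
      using z assms(1) by (intro divide_left_mono power_mono) auto
    then show "norm (1 / 4 * (1 + 3 / z ^ 4)) \<le> 1 / 4 * (1 + 3 / k ^ 4)"
      using z by simp
  qed (use assms in auto)
  then show ?thesis by simp
qed

text \<open>The danger is the wall x = -1. Bounded velocity over a finite time bounds the energy,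
  whose term 1 / (2 u^2) keeps u away from 0; the force can then be altered near the wall into a
  globally Lipschitz one.\<close>

lemma bounded_solution_extends_right:
  assumes sol: "solution_on pinney_force q {-1<..} I x" and q: "continuous_on UNIV q"
    and M: "\<And>t. t \<in> I \<Longrightarrow> \<bar>x t\<bar> + \<bar>deriv x t\<bar> \<le> M"
    and cd: "c \<in> I" "d \<notin> I" "c < d"
  obtains J y where "solution_on pinney_force q {-1<..} J y" "I \<subseteq> J"
    "\<And>t. t \<in> I \<Longrightarrow> y t = x t" "J \<noteq> I"
proof -
  have I: "open I" "is_interval I" using sol by (auto simp: solution_on_def)
  have "t \<le> d" if "t \<in> I" for t
    using mem_is_interval_1_I[OF I(2) cd(1) that, of d] cd(2,3) by linarith
  then have bdd: "bdd_above I" by (auto simp: bdd_above_def)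
  define b where "b = Sup I"
  have le_b: "t \<le> b" if "t \<in> I" for t unfolding b_def by (rule cSup_upper[OF that bdd])
  have bI: "b \<notin> I"
  proof
    assume "b \<in> I"
    then obtain e where e: "e > 0" "ball b e \<subseteq> I" using I(1) open_contains_ball by blast
    then have "b + e / 2 \<in> I" by (auto simp: dist_real_def intro!: subsetD[OF e(2)])
    then show False using le_b[of "b + e / 2"] e(1) by simp
  qed
  have cb: "c < b" using le_b[OF cd(1)] cd(1) bI by (cases "c = b") auto
  have I_less: "I \<subseteq> {..<b}" using le_b bI by (auto simp: less_le)
  have sub: "{c..<b} \<subseteq> I"
  proof
    fix t assume t: "t \<in> {c..<b}"
    then obtain s where "s \<in> I" "t < s"
      using less_cSup_iff[of I t] bdd cd(1) unfolding b_def by auto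
    then show "t \<in> I" using mem_is_interval_1_I[OF I(2) cd(1), of s t] t by auto
  qed
  have "bounded (q ` {c..b})"
    by (intro compact_imp_bounded compact_continuous_image continuous_on_subset[OF q]) auto
  then obtain Q where "\<forall>t\<in>{c..b}. \<bar>q t\<bar> \<le> Q" by (auto simp: bounded_iff)
  then have Q: "\<bar>q t\<bar> \<le> Q" if "t \<in> {c..<b}" for t using that by auto
  have v: "\<bar>deriv x t\<bar> \<le> M" and xM: "x t \<le> M" if "t \<in> {c..<b}" for t
    using M[of t] sub that by fastforce+
  have Q0: "Q \<ge> 0" and M0: "M \<ge> 0" using Q[of c] v[of c] cb by fastforce+
  define E where "E t = 2 * (deriv x t)\<^sup>2 + (x t + 1)\<^sup>2 / 2 + 1 / (2 * (x t + 1)\<^sup>2)" for t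
  \<comment> \<open>The energy changes at rate at most 4 M Q during a time shorter than b -
    c.\<close>
  define H where "H = E c + 4 * M * Q * (b - c)"
  have E_le: "E t \<le> H" if t: "t \<in> {c..<b}" for t
  proof -
    have "norm (E t - E c) \<le> 4 * M * Q * norm (t - c)"
    proof (rule field_differentiable_bound[of "{c..<b}" E "\<lambda>t. 4 * deriv x t * q t"])
      fix s assume s: "s \<in> {c..<b}"
      then have "s \<in> I" using sub by blast
      from DERIV_pinney_energy[OF pinney_solution_on_D[OF sol this]]
      show "(E has_field_derivative 4 * deriv x s * q s) (at s within {c..<b})"
        unfolding E_def[abs_def] by (rule has_field_derivative_at_within)
      show "norm (4 * deriv x s * q s) \<le> 4 * M * Q"
        using mult_mono[OF v[OF s] Q[OF s] M0 abs_ge_zero] by (simp add: abs_mult)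
    qed (use t cb in auto)
    also have "\<dots> \<le> 4 * M * Q * (b - c)"
      using t M0 Q0 by (intro mult_left_mono) auto
    finally show ?thesis unfolding H_def by simp
  qed
  have E_ge: "1 / (2 * (x t + 1)\<^sup>2) \<le> E t" for t by (simp add: E_def)
  have u: "x t + 1 > 0" if "t \<in> I" for t using pinney_solution_on_D(3)[OF sol that] .
  have "0 < 1 / (2 * (x c + 1)\<^sup>2)" using u[OF cd(1)] by simp
  also have "\<dots> \<le> E c" by (rule E_ge)
  also have "\<dots> \<le> H" using E_le cb by simp
  finally have H: "H > 0" .
  \<comment> \<open>1 / (2 u^2) \<le> H is the same as u \<ge> 1 / sqrt (2 H).\<close>
  define m where "m = 1 / sqrt (2 * H)"
  have m: "m > 0" using H by (simp add: m_def)
  have x_ge: "m \<le> x t + 1" if t: "t \<in> {c..<b}" for t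
  proof (rule power2_le_imp_le)
    have u: "x t + 1 > 0" using u t sub by blast
    have "1 / (2 * (x t + 1)\<^sup>2) \<le> H" using E_ge E_le[OF t] order_trans by blast
    then have "1 / (2 * H) \<le> (x t + 1)\<^sup>2" using u H by (simp add: field_simps)
    then show "m\<^sup>2 \<le> (x t + 1)\<^sup>2" using H by (simp add: m_def power_divide)
    show "0 \<le> x t + 1" using u by simp
  qed
  \<comment> \<open>Cutting at m / 2 instead of m places the compact range of x inside an open set
    on which \<open>G\<close> is the true force.\<close>
  define G where "G z = 1 / 4 * (max (z + 1) (m / 2) - 1 / (max (z + 1) (m / 2)) ^ 3)" for z
  define K where "K = 1 / 4 * (1 + 3 / (m / 2) ^ 4)"
  show thesis
  proof (rule solution_extends_right[OF sol q, of G K "{m / 2 - 1<..}" "{m - 1..M}" c b M])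
    fix y z :: real
    have "\<bar>G y - G z\<bar> \<le> K * \<bar>max (y + 1) (m / 2) - max (z + 1) (m / 2)\<bar>"
      unfolding G_def K_def by (rule pinney_force_lipschitz) (use m in auto)
    also have "\<dots> \<le> K * \<bar>y - z\<bar>"
      by (rule mult_left_mono) (auto simp: K_def)
    finally show "\<bar>G y - G z\<bar> \<le> K * \<bar>y - z\<bar>" .
  next
    show "G z = pinney_force z" if "z \<in> {m / 2 - 1<..}" for z
      using that by (simp add: G_def max_def)
    show "x t \<in> {m - 1..M}" if "c \<le> t" "t < b" for t using x_ge[of t] xM[of t] that by auto
    show "\<bar>deriv x t\<bar> \<le> M" if "c \<le> t" "t < b" for t using v[of t] that by auto
  qed (use m cb bI sub I_less that in auto)
qed

lemma bounded_maximal_solution_global: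
  assumes max: "maximal_solution pinney_force q {-1<..} I x" and q: "continuous_on UNIV q"
    and M: "\<And>t. t \<in> I \<Longrightarrow> \<bar>x t\<bar> + \<bar>deriv x t\<bar> \<le> M"
  shows "I = UNIV"
proof (rule ccontr)
  have sol: "solution_on pinney_force q {-1<..} I x"
    and ext: "\<And>J y. solution_on pinney_force q {-1<..} J y \<Longrightarrow> I \<subseteq> J \<Longrightarrow> \<forall>t\<in>I. y t = x t \<Longrightarrow> J = I"
    using max unfolding maximal_solution_def by blast+
  obtain c where c: "c \<in> I" using sol by (auto simp: solution_on_def)
  assume "I \<noteq> UNIV"
  then obtain d where d: "d \<notin> I" by blast
  then consider "c < d" | "d < c" using c by (cases c d rule: linorder_cases) auto
  then show False
  proof cases
    case 1
    obtain J y where "solution_on pinney_force q {-1<..} J y" "I \<subseteq> J" "\<And>t. t \<in> I \<Longrightarrow> y t = x t" "J \<noteq> I"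
      by (rule bounded_solution_extends_right[OF sol q M c d 1]) (assumption, rule that)
    then show False using ext by blast
  next
    case 2
    \<comment> \<open>Time reversal moves the missing point d to the right of the interval.\<close>
    have sol': "solution_on pinney_force (\<lambda>t. q (- t)) {-1<..} (uminus ` I) (\<lambda>t. x (- t))"
      by (rule solution_on_reflect[OF sol])
    have q': "continuous_on UNIV (\<lambda>t. q (- t))"
      by (rule continuous_on_compose2[OF q]) (auto intro: continuous_intros)
    have M': "\<bar>x (- t)\<bar> + \<bar>deriv (\<lambda>t. x (- t)) t\<bar> \<le> M" if "t \<in> uminus ` I" for t
    proof -
      have t: "- t \<in> I" using that by auto
      have "((\<lambda>t. x (- t)) has_real_derivative deriv x (- t) * - 1) (at t)"
        by (rule DERIV_chain2[where g = "\<lambda>t. - t", OF solution_onD(2)[OF sol t]]) (auto intro!: derivative_eq_intros)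
      then have "deriv (\<lambda>t. x (- t)) t = - deriv x (- t)" using DERIV_imp_deriv by fastforce
      then show ?thesis using M[OF t] by simp
    qed
    have cd: "- c \<in> uminus ` I" "- d \<notin> uminus ` I" "- c < - d" using c d 2 by auto
    obtain J y where J: "solution_on pinney_force (\<lambda>t. q (- t)) {-1<..} J y" "uminus ` I \<subseteq> J"
        "\<And>t. t \<in> uminus ` I \<Longrightarrow> y t = x (- t)" "J \<noteq> uminus ` I"
      by (rule bounded_solution_extends_right[OF sol' q' M' cd]) (assumption, rule that)
    have "solution_on pinney_force q {-1<..} (uminus ` J) (\<lambda>t. y (- t))"
      using solution_on_reflect[OF J(1)] by simp
    moreover have "I \<subseteq> uminus ` J" using J(2) by force
    ultimately have "uminus ` J = I" using ext J(3) by simp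
    then have "J = uminus ` I" by (auto simp: image_image)
    then show False using J(4) by simp
  qed
qed

text \<open>Otherwise a time can be chosen for each natural number n at which the sum is at least n,
  and these times form a forbidden sequence.\<close>

lemma not_unbounded_solution_bound:
  assumes "\<not> unbounded_solution I x"
  obtains M where "\<And>t. t \<in> I \<Longrightarrow> \<bar>x t\<bar> + \<bar>deriv x t\<bar> \<le> M"
proof (rule ccontr)
  assume *: "\<not> thesis"
  have "\<exists>t\<in>I. real n \<le> \<bar>x t\<bar> + \<bar>deriv x t\<bar>" for n
    using that[of "real n"] * by (meson linear)
  then obtain s where s: "\<And>n. s n \<in> I" "\<And>n. real n \<le> \<bar>x (s n)\<bar> + \<bar>deriv x (s n)\<bar>"
    by metis
  have "filterlim (\<lambda>n. \<bar>x (s n)\<bar> + \<bar>deriv x (s n)\<bar>) at_top sequentially"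
    by (rule filterlim_at_top_mono[OF filterlim_real_sequentially]) (use s(2) in auto)
  then show False using assms s(1) unfolding unbounded_solution_def by blast
qed

theorem corollary2p4:
  fixes a0 a1 b1 :: real and p :: "real \<Rightarrow> real"
  assumes p: "\<And>t. p t = a0 + a1 * cos t + b1 * sin t"
    and ineq: "a1\<^sup>2 + b1\<^sup>2 > 9 * a0\<^sup>2"
  shows "\<exists>\<epsilon>0>0. \<forall>\<epsilon>. 0 < \<bar>\<epsilon>\<bar> \<and> \<bar>\<epsilon>\<bar> < \<epsilon>0 \<longrightarrow>
    resonant (\<lambda>x. 1 / 4 * (x + 1 - 1 / (x + 1) ^ 3)) (\<lambda>t. \<epsilon> * p t) {-1<..}"
proof -
  obtain \<epsilon>0 where \<epsilon>0: "\<epsilon>0 > 0"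
    and unb: "\<And>e u v M. 0 < \<bar>e\<bar> \<Longrightarrow> \<bar>e\<bar> < \<epsilon>0 \<Longrightarrow>
      pinney_solution u v (\<lambda>t. e * (a0 + a1 * cos t + b1 * sin t)) \<Longrightarrow> \<exists>t. M < \<bar>u t\<bar> + \<bar>v t\<bar>"
    by (rule pinney_unbounded[OF ineq]) (rule that)
  have "unbounded_solution I x"
    if e: "0 < \<bar>e\<bar>" "\<bar>e\<bar> < \<epsilon>0" and max: "maximal_solution pinney_force (\<lambda>t. e * p t) {-1<..} I x" for e I x
  proof (rule ccontr)
    assume "\<not> unbounded_solution I x"
    then obtain M where M: "\<And>t. t \<in> I \<Longrightarrow> \<bar>x t\<bar> + \<bar>deriv x t\<bar> \<le> M"
      by (rule not_unbounded_solution_bound) (rule that)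
    have "continuous_on UNIV (\<lambda>t. e * p t)" unfolding p by (intro continuous_intros)
    from bounded_maximal_solution_global[OF max this M] have I: "I = UNIV" .
    have sol: "solution_on pinney_force (\<lambda>t. e * p t) {-1<..} UNIV x"
      using max unfolding maximal_solution_def I by blast
    have "pinney_solution (\<lambda>t. x t + 1) (deriv x) (\<lambda>t. e * (a0 + a1 * cos t + b1 * sin t))"
      unfolding p[symmetric] by unfold_locales (rule pinney_solution_on_D[OF sol UNIV_I])+
    \<comment> \<open>M + 1 accounts for the shift u = x + 1.\<close>
    from unb[OF e this, of "M + 1"] obtain t where "M + 1 < \<bar>x t + 1\<bar> + \<bar>deriv x t\<bar>" by blast
    then show False using M[of t] I by simp
  qed
  then show ?thesis unfolding resonant_def using \<epsilon>0 by blast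
qed

end
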